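(* Let $d\ge 2$ be an integer and let $\mathbb{F}=\mathbb{F}_2$ be the field with two elements. Then for every infinite field $\mathbb{L}$ of characteristic $2$ we have: (a) $C_{3,d}^{\mathbb{F}}=C_{3,d}^{\mathbb{L}}$, and this common value is $6$ if $d=2$ and $d+3$ if $d\ge 3$; (b) $\dim_{\mathbb{F}} N_{3,d}^{\mathbb{F}}=\dim_{\mathbb{L}} N_{3,d}^{\mathbb{L}}+d(d-1)/2$.
   Context: $\langle X\rangle_d$ is the free semigroup (without unity) on letters $x_1,\dots,x_d$; for a field $\mathbb{K}$, $\mathbb{K}\langle X\rangle_d$ is the semigroup algebra, i.e. the free associative non-unital $\mathbb{K}$-algebra on $x_1,\dots,x_d$. Define $N_{n,d}^{\mathbb{K}}=\mathbb{K}\langle X\rangle_d/\mathrm{id}\{x^n\mid x\in\mathbb{K}\langle X\rangle_d\}$, the quotient by the two-sided ideal generated by all $n$-th powers of elements. It is a nilpotent algebra, and $C_{n,d}^{\mathbb{K}}=\min\{c>0\mid a_1\cdots a_c=0\text{ for all }a_1,\dots,a_c\in N_{n,d}^{\mathbb{K}}\}$ is its nilpotency degree. *)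

theory Defs
  imports
    "HOL-Algebra.QuotRing"
    "HOL-Library.Poly_Mapping"
    "HOL-Library.Z2"
    "Jordan_Normal_Form.VS_Connect"
begin

text \<open>
  The free monoid on \<open>'a\<close>, written additively because the convolution product of
  \<^typ>\<open>'a \<Rightarrow>\<^sub>0 'b\<close> is defined for exponents in the class \<^class>\<open>monoid_add\<close>.
  The addition is concatenation and is not commutative.
\<close>

datatype 'a fword = Word (letters: "'a list")

instantiation fword :: (type) monoid_add
begin

definition zero_fword :: "'a fword"
  where "0 = Word []"

definition plus_fword :: "'a fword \<Rightarrow> 'a fword \<Rightarrow> 'a fword"
  where "u + v = Word (letters u @ letters v)"

instance
  by standard (simp_all add: zero_fword_def plus_fword_def)

end

text \<open>
  Algebras over the field \<open>'k\<close> are module records over \<open>class_ring :: 'k ring\<close>; the algebra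
  product is the multiplication of the record. The algebras here have no unit, so the \<^const>\<open>one\<close>
  component of the records is a dummy to which nothing refers.

  The semigroup algebra of the free semigroup on the letters \<open>1, \<dots>, d\<close> consists of the elements
  of the monoid algebra of the free monoid that are supported on nonempty words in these letters.
\<close>

type_synonym 'k nc_poly = "nat fword \<Rightarrow>\<^sub>0 'k"

definition free_alg :: "nat \<Rightarrow> ('k::field, 'k nc_poly) module"
  where "free_alg d =
    \<lparr>carrier = {p. \<forall>w\<in>Poly_Mapping.keys p. letters w \<noteq> [] \<and> set (letters w) \<subseteq> {1..d}},
     monoid.mult = (*), one = undefined, zero = 0, add = (+),
     module.smult = (\<lambda>c. Poly_Mapping.map ((*) c))\<rparr>"

text \<open>
  Ideals are ideals of algebras, hence linear subspaces: without a unit, closure under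
  multiplication by scalars does not follow from closure under multiplication by elements.
\<close>

definition alg_ideal :: "('k::field, 'v, 'm) module_scheme \<Rightarrow> 'v set \<Rightarrow> bool"
  where "alg_ideal A I \<longleftrightarrow> Module.submodule I (class_ring :: 'k ring) A \<and>
    (\<forall>x\<in>I. \<forall>a\<in>carrier A. a \<otimes>\<^bsub>A\<^esub> x \<in> I \<and> x \<otimes>\<^bsub>A\<^esub> a \<in> I)"

definition gen_ideal :: "('k::field, 'v, 'm) module_scheme \<Rightarrow> 'v set \<Rightarrow> 'v set"
  where "gen_ideal A S = \<Inter>{I. alg_ideal A I \<and> S \<subseteq> I}"

text \<open>
  The quotient algebra: as in \<^const>\<open>FactRing\<close>, with scalar multiplication added; \<open>c (a + I)\<close> is
  \<open>c a + I\<close>.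
\<close>

definition quot_alg :: "('k::field, 'v, 'm) module_scheme \<Rightarrow> 'v set \<Rightarrow> ('k, 'v set) module"
  where "quot_alg A I =
    \<lparr>carrier = a_rcosets\<^bsub>A\<^esub> I, monoid.mult = rcoset_mult A I, one = undefined, zero = I,
     add = set_add A, module.smult = (\<lambda>c X. \<Union>x\<in>X. I +>\<^bsub>A\<^esub> (c \<odot>\<^bsub>A\<^esub> x))\<rparr>"

text \<open>The product \<open>a\<^sub>1 \<cdots> a\<^sub>c\<close> of a nonempty list; it is meaningless for the empty list.\<close>

definition list_mult :: "('k, 'v, 'm) module_scheme \<Rightarrow> 'v list \<Rightarrow> 'v"
  where "list_mult A as = foldl (monoid.mult A) (hd as) (tl as)"

definition N_alg :: "nat \<Rightarrow> nat \<Rightarrow> ('k::field, 'k nc_poly set) module"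
  where "N_alg n d =
    quot_alg (free_alg d)
      (gen_ideal (free_alg d)
        {list_mult (free_alg d) (replicate n x) | x. x \<in> carrier (free_alg d :: ('k, _) module)})"

definition nilpotency_degree :: "('k, 'v, 'm) module_scheme \<Rightarrow> nat"
  where "nilpotency_degree A =
    Inf {c. 0 < c \<and> (\<forall>as. length as = c \<and> set as \<subseteq> carrier A \<longrightarrow> list_mult A as = \<zero>\<^bsub>A\<^esub>)}"

definition C_deg :: "nat \<Rightarrow> nat \<Rightarrow> 'k::field itself \<Rightarrow> nat"
  where "C_deg n d K = nilpotency_degree (N_alg n d :: ('k, _) module)"

abbreviation alg_fin_dim :: "('k::field, 'v, 'm) module_scheme \<Rightarrow> bool"
  where "alg_fin_dim A \<equiv> vectorspace.fin_dim (class_ring :: 'k ring) A"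

abbreviation alg_dim :: "('k::field, 'v, 'm) module_scheme \<Rightarrow> nat"
  where "alg_dim A \<equiv> vectorspace.dim (class_ring :: 'k ring) A"

text \<open>
  The records above are vector spaces with a well-defined product, so that the notions of
  \<^locale>\<open>vectorspace\<close> apply to them.
\<close>

lemma lookup_smult: "Poly_Mapping.lookup (Poly_Mapping.map ((*) c) p) w = c * Poly_Mapping.lookup p w"
  for c :: "'k::field"
  by (simp add: Poly_Mapping.map.rep_eq when_def)

lemma module_free_alg: "module (class_ring :: 'k::field ring) (free_alg d)"
proof (rule moduleI)
  show "cring (class_ring :: 'k ring)" by (rule class_cring.is_cring)
  show "abelian_group (free_alg d :: ('k, _) module)"
  proof (rule abelian_groupI)
    fix x :: "'k nc_poly" assume x: "x \<in> carrier (free_alg d)"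
    show "\<exists>y\<in>carrier (free_alg d). y \<oplus>\<^bsub>free_alg d\<^esub> x = \<zero>\<^bsub>free_alg d\<^esub>"
      using x by (intro bexI[of _ "- x"]) (auto simp: free_alg_def)
  next
    fix x y :: "'k nc_poly" assume "x \<in> carrier (free_alg d)" "y \<in> carrier (free_alg d)"
    then show "x \<oplus>\<^bsub>free_alg d\<^esub> y \<in> carrier (free_alg d)"
      using keys_add[of x y] by (auto simp: free_alg_def)
  qed (auto simp: free_alg_def algebra_simps)
qed (auto simp: free_alg_def in_keys_iff lookup_smult lookup_add algebra_simps intro!: poly_mapping_eqI)

lemma free_alg_mult_closed:
  "x \<in> carrier (free_alg d) \<Longrightarrow> y \<in> carrier (free_alg d) \<Longrightarrow> x \<otimes>\<^bsub>free_alg d\<^esub> y \<in> carrier (free_alg d)"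
  using keys_mult[of x y] by (auto simp: free_alg_def plus_fword_def dest!: subsetD) fastforce+

lemma alg_ideal_carrier: "alg_ideal (free_alg d) (carrier (free_alg d))"
  unfolding alg_ideal_def using module.carrier_is_submodule[OF module_free_alg] free_alg_mult_closed by auto

lemma alg_ideal_gen_ideal:
  fixes S :: "'k::field nc_poly set"
  assumes "S \<subseteq> carrier (free_alg d)"
  shows "alg_ideal (free_alg d) (gen_ideal (free_alg d) S)"
proof -
  let ?A = "free_alg d :: ('k, _) module"
  interpret Module.module "class_ring :: 'k ring" ?A by (rule module_free_alg)
  have c: "gen_ideal ?A S \<subseteq> carrier ?A"
    unfolding gen_ideal_def using alg_ideal_carrier assms by blast
  have "Module.submodule (gen_ideal ?A S) (class_ring :: 'k ring) ?A"
  proof (rule submoduleI)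
    show "gen_ideal ?A S \<subseteq> carrier ?A" by (rule c)
    show "\<zero>\<^bsub>?A\<^esub> \<in> gen_ideal ?A S"
      unfolding gen_ideal_def alg_ideal_def Module.submodule_def
      by (auto dest: subgroup.one_closed)
  qed (simp_all add: gen_ideal_def alg_ideal_def submoduleE)
  then show ?thesis by (auto simp: gen_ideal_def alg_ideal_def)
qed

lemma vectorspace_quot_alg:
  fixes A :: "('k::field, 'v, 'm) module_scheme"
  assumes "module (class_ring :: 'k ring) A" and "alg_ideal A I"
  shows "vectorspace (class_ring :: 'k ring) (quot_alg A I)"
proof -
  interpret Module.module "class_ring :: 'k ring" A by fact
  have sub: "Module.submodule I (class_ring :: 'k ring) A" using assms(2) by (simp add: alg_ideal_def)
  interpret abelian_subgroup I A
    by (rule abelian_subgroupI3) (auto intro: additive_subgroupI sub[unfolded Module.submodule_def, THEN conjunct1] M.abelian_group_axioms)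
  have sm: "(\<Union>x\<in>I +>\<^bsub>A\<^esub> a. I +>\<^bsub>A\<^esub> (c \<odot>\<^bsub>A\<^esub> x)) = I +>\<^bsub>A\<^esub> (c \<odot>\<^bsub>A\<^esub> a)" if a: "a \<in> carrier A" for a c
  proof -
    have "I +>\<^bsub>A\<^esub> (c \<odot>\<^bsub>A\<^esub> x) = I +>\<^bsub>A\<^esub> (c \<odot>\<^bsub>A\<^esub> a)" if "x \<in> I +>\<^bsub>A\<^esub> a" for x
    proof -
      from that obtain i where i: "i \<in> I" "x = i \<oplus>\<^bsub>A\<^esub> a" by (auto simp: a_r_coset_def')
      have "c \<odot>\<^bsub>A\<^esub> x = c \<odot>\<^bsub>A\<^esub> i \<oplus>\<^bsub>A\<^esub> c \<odot>\<^bsub>A\<^esub> a"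
        using i a by (simp add: smult_r_distr)
      moreover have "c \<odot>\<^bsub>A\<^esub> i \<in> I" using submoduleE(4)[OF sub] i by simp
      ultimately have "c \<odot>\<^bsub>A\<^esub> x \<in> I +>\<^bsub>A\<^esub> (c \<odot>\<^bsub>A\<^esub> a)" by (auto simp: a_r_coset_def')
      then show ?thesis using a_repr_independence'[of "c \<odot>\<^bsub>A\<^esub> x" "c \<odot>\<^bsub>A\<^esub> a"] a by simp
    qed
    moreover have "a \<in> I +>\<^bsub>A\<^esub> a" using a by (rule a_rcos_self)
    ultimately show ?thesis by (blast 5)
  qed
  have carr: "carrier (quot_alg A I) = (\<lambda>a. I +>\<^bsub>A\<^esub> a) ` carrier A"
    by (auto simp: quot_alg_def A_RCOSETS_def')
  have add: "(I +>\<^bsub>A\<^esub> a) \<oplus>\<^bsub>quot_alg A I\<^esub> (I +>\<^bsub>A\<^esub> b) = I +>\<^bsub>A\<^esub> (a \<oplus>\<^bsub>A\<^esub> b)"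
    if "a \<in> carrier A" "b \<in> carrier A" for a b
    using that by (simp add: quot_alg_def a_rcos_sum)
  have smult: "c \<odot>\<^bsub>quot_alg A I\<^esub> (I +>\<^bsub>A\<^esub> a) = I +>\<^bsub>A\<^esub> (c \<odot>\<^bsub>A\<^esub> a)" if "a \<in> carrier A" for a c
    using sm[OF that] by (simp add: quot_alg_def)
  have zero: "\<zero>\<^bsub>quot_alg A I\<^esub> = I +>\<^bsub>A\<^esub> \<zero>\<^bsub>A\<^esub>" by (simp add: quot_alg_def a_subset)
  have "module (class_ring :: 'k ring) (quot_alg A I)"
  proof (rule moduleI)
    show "cring (class_ring :: 'k ring)" by (rule class_cring.is_cring)
    show "abelian_group (quot_alg A I)"
    proof (rule abelian_groupI)
      fix x assume "x \<in> carrier (quot_alg A I)"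
      then obtain a where "a \<in> carrier A" "x = I +>\<^bsub>A\<^esub> a" by (auto simp: carr)
      then show "\<exists>y\<in>carrier (quot_alg A I). y \<oplus>\<^bsub>quot_alg A I\<^esub> x = \<zero>\<^bsub>quot_alg A I\<^esub>"
        by (intro bexI[of _ "I +>\<^bsub>A\<^esub> (\<ominus>\<^bsub>A\<^esub> a)"]) (auto simp: add zero M.l_neg carr)
    qed (auto simp: carr add zero M.a_ac)
  next
    have *: "\<And>a b x. x \<in> carrier A \<Longrightarrow> (a + b) \<odot>\<^bsub>A\<^esub> x = a \<odot>\<^bsub>A\<^esub> x \<oplus>\<^bsub>A\<^esub> b \<odot>\<^bsub>A\<^esub> x"
      "\<And>a b x. x \<in> carrier A \<Longrightarrow> (a * b) \<odot>\<^bsub>A\<^esub> x = a \<odot>\<^bsub>A\<^esub> (b \<odot>\<^bsub>A\<^esub> x)"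
      "\<And>x. x \<in> carrier A \<Longrightarrow> 1 \<odot>\<^bsub>A\<^esub> x = x"
      using smult_l_distr smult_assoc1 smult_one by auto
  qed (use smult_l_distr smult_assoc1 smult_one in \<open>auto simp: carr add smult smult_r_distr\<close>)
  then show ?thesis by (intro vectorspace.intro class_field)
qed

lemma quot_alg_mult:
  fixes I :: "'k::field nc_poly set"
  assumes I: "alg_ideal (free_alg d) I"
    and a: "a \<in> carrier (free_alg d)" and b: "b \<in> carrier (free_alg d)"
  shows "(I +>\<^bsub>free_alg d\<^esub> a) \<otimes>\<^bsub>quot_alg (free_alg d) I\<^esub> (I +>\<^bsub>free_alg d\<^esub> b)
    = I +>\<^bsub>free_alg d\<^esub> (a \<otimes>\<^bsub>free_alg d\<^esub> b)"
proof -
  let ?A = "free_alg d :: ('k, _) module"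
  interpret Module.module "class_ring :: 'k ring" ?A by (rule module_free_alg)
  have sub: "Module.submodule I (class_ring :: 'k ring) ?A" using I by (simp add: alg_ideal_def)
  interpret abelian_subgroup I ?A
    by (rule abelian_subgroupI3)
      (auto intro: additive_subgroupI sub[unfolded Module.submodule_def, THEN conjunct1] M.abelian_group_axioms)
  have "I +>\<^bsub>?A\<^esub> (x \<otimes>\<^bsub>?A\<^esub> y) = I +>\<^bsub>?A\<^esub> (a \<otimes>\<^bsub>?A\<^esub> b)"
    if "x \<in> I +>\<^bsub>?A\<^esub> a" "y \<in> I +>\<^bsub>?A\<^esub> b" for x y
  proof -
    from that obtain i j where ij: "i \<in> I" "x = i \<oplus>\<^bsub>?A\<^esub> a" "j \<in> I" "y = j \<oplus>\<^bsub>?A\<^esub> b"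
      by (auto simp: a_r_coset_def')
    then have cij: "i \<in> carrier ?A" "j \<in> carrier ?A" by (auto intro: a_Hcarr)
    have "x \<otimes>\<^bsub>?A\<^esub> y = (i \<otimes>\<^bsub>?A\<^esub> (j \<oplus>\<^bsub>?A\<^esub> b) \<oplus>\<^bsub>?A\<^esub> a \<otimes>\<^bsub>?A\<^esub> j) \<oplus>\<^bsub>?A\<^esub> a \<otimes>\<^bsub>?A\<^esub> b"
      using ij by (simp add: free_alg_def algebra_simps)
    moreover have "i \<otimes>\<^bsub>?A\<^esub> (j \<oplus>\<^bsub>?A\<^esub> b) \<oplus>\<^bsub>?A\<^esub> a \<otimes>\<^bsub>?A\<^esub> j \<in> I"
      using I ij a b cij unfolding alg_ideal_def by (intro a_closed) auto
    ultimately have "x \<otimes>\<^bsub>?A\<^esub> y \<in> I +>\<^bsub>?A\<^esub> (a \<otimes>\<^bsub>?A\<^esub> b)" by (auto simp: a_r_coset_def')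
    then show ?thesis
      using a_repr_independence' free_alg_mult_closed[OF a b] by metis
  qed
  moreover have "a \<in> I +>\<^bsub>?A\<^esub> a" "b \<in> I +>\<^bsub>?A\<^esub> b" using a b by (auto intro: a_rcos_self)
  ultimately have "(\<Union>x\<in>I +>\<^bsub>?A\<^esub> a. \<Union>y\<in>I +>\<^bsub>?A\<^esub> b. I +>\<^bsub>?A\<^esub> (x \<otimes>\<^bsub>?A\<^esub> y)) = I +>\<^bsub>?A\<^esub> (a \<otimes>\<^bsub>?A\<^esub> b)"
    by (blast 5)
  then show ?thesis by (simp add: quot_alg_def rcoset_mult_def)
qed

lemma vectorspace_N_alg:
  assumes "n \<ge> 1"
  shows "vectorspace (class_ring :: 'k::field ring) (N_alg n d)"
proof -
  have "foldl (monoid.mult (free_alg d)) x (replicate m y) \<in> carrier (free_alg d)"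
    if "x \<in> carrier (free_alg d)" "y \<in> carrier (free_alg d)" for x y :: "'k nc_poly" and m
    using that(1) by (induction m arbitrary: x) (auto intro: free_alg_mult_closed that)
  then show ?thesis using assms unfolding N_alg_def
    by (intro vectorspace_quot_alg module_free_alg alg_ideal_gen_ideal)
      (auto simp: list_mult_def)
qed

end

(*
Write B(x,y) = x^2 y + x y x + y x^2 and P(x,y,z) for the sum of the six products of x, y, z. Over
an infinite field of characteristic 2 the cubes generate the same ideal J as the elements a^3,
B(a,b), P(a,b,c) for words a, b, c. Over F_2 the cubes only yield a^3, P(a,b,c) and
B(a,b) + B(b,a), but explicit identities show that B(a,b) already lies in the cube ideal I as soon
as ab has length at least 3 or B(a,b) is multiplied by something. So J is spanned modulo I by the
elements B(x_i,x_j), and the coefficients of x_i^2 x_j and x_j^2 x_i, which agree on I, show that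
those with i < j are independent modulo I. A basis of words of the quotient by J over F_2, with its
coordinate functionals, lifts to every field of characteristic 2; this compares the dimensions.

For the nilpotency degree, x a x = x^2 a + a x^2 moves equal letters together. A word of length at
least max(6, d + 3) contains a letter four times, or one letter three times and another one twice,
or three letters twice, and each of these cases vanishes by polarizing x^2 y^2 z^2 = 0. The bound
is sharp because the parity of the number of factors x_1 x_1 is a functional that kills J in the
multidegree (3,1,...,1), respectively (3,2) for d = 2.
*)
theory Submission
  imports Defs
begin

subsection \<open>Consequences of the identity \<open>x\<^sup>3 = 0\<close> in characteristic 2\<close>

text \<open>Over F_2 rescaling cannot separate the homogeneous components of a cube, so B(x,y) stays
  tied to B(y,x), which has another multidegree. The way out is to substitute products for the
  variables: this gives relations that mix several multidegrees, and these can be played off against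
  each other. \<open>nil_cube\<close> therefore argues with addition and multiplication alone, and
  its results hold over every field of characteristic 2. The two halves of the nilpotency degree use
  different ideals. Vanishing is proved in the smaller ideal I and nonvanishing outside the larger
  ideal J, so the value cannot depend on the field. The constant 6 counts factors. Two equal factors
  t, t can be merged into one factor t^2 only where B(t,a) is known to lie in I, which requires a
  further factor somewhere; each merger also shortens the product by one. Short products can indeed
  survive, such as x_1^2 x_2^2 x_1 for d = 2.\<close>

definition lin2 :: "'r::ring_1 \<Rightarrow> 'r \<Rightarrow> 'r"
  where "lin2 x y = x * x * y + x * y * x + y * x * x"

definition lin3 :: "'r::ring_1 \<Rightarrow> 'r \<Rightarrow> 'r \<Rightarrow> 'r"
  where "lin3 x y z = x * y * z + x * z * y + y * x * z + y * z * x + z * x * y + z * y * x"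

text \<open>\<open>S\<close> is an algebra without unit inside a ring with unit, so that an empty
  context can be written as 1. The ideal \<open>I\<close> absorbs factors from \<open>S\<close>
  only. Scalars are left out on purpose.\<close>

locale nil_cube =
  fixes S I :: "'r::ring_1 set"
  assumes double_zero [simp]: "(x::'r) + x = 0"
    and S_add [intro, simp]: "x \<in> S \<Longrightarrow> y \<in> S \<Longrightarrow> x + y \<in> S"
    and S_mult [intro, simp]: "x \<in> S \<Longrightarrow> y \<in> S \<Longrightarrow> x * y \<in> S"
    and I_subset: "I \<subseteq> S"
    and I_zero [intro, simp]: "0 \<in> I"
    and I_add [intro]: "x \<in> I \<Longrightarrow> y \<in> I \<Longrightarrow> x + y \<in> I"
    and I_mult_left [intro]: "a \<in> S \<Longrightarrow> x \<in> I \<Longrightarrow> a * x \<in> I"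
    and I_mult_right [intro]: "x \<in> I \<Longrightarrow> a \<in> S \<Longrightarrow> x * a \<in> I"
    and cube_in [intro]: "x \<in> S \<Longrightarrow> x * x * x \<in> I"
begin

lemma add_cancel_left_double [simp]: "(x::'r) + (x + y) = y"
  by (simp flip: add.assoc)

lemmas expand = distrib_left distrib_right mult.assoc add_ac

text \<open>Inclusion-exclusion over the nonempty subsets of the three variables leaves the
  monomials that involve all of them; characteristic 2 removes the signs.\<close>

lemma lin3_in [intro]:
  assumes "x \<in> S" "y \<in> S" "z \<in> S" shows "lin3 x y z \<in> I"
proof -
  let ?c = "\<lambda>t. t * t * t"
  have "lin3 x y z = ?c (x + y + z) + ?c (x + y) + ?c (x + z) + ?c (y + z) + ?c x + ?c y + ?c z"
    by (simp add: lin3_def expand)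
  also have "\<dots> \<in> I"
    using assms by (intro I_add cube_in S_add)
  finally show ?thesis .
qed

text \<open>This is the mixed part of the cube of \<open>x + y\<close>. Its two halves differ in
  multidegree; the next lemmas recover a single half in a nontrivial context.\<close>

lemma lin2_swap_in [intro]:
  assumes "x \<in> S" "y \<in> S" shows "lin2 x y + lin2 y x \<in> I"
proof -
  let ?c = "\<lambda>t. t * t * t"
  have "lin2 x y + lin2 y x = ?c (x + y) + ?c x + ?c y"
    by (simp add: lin2_def expand)
  also have "\<dots> \<in> I"
    using assms by (intro I_add cube_in S_add)
  finally show ?thesis .
qed

text \<open>The terms \<open>lin2 x (z * y)\<close>, \<open>lin3 x z (x * y)\<close> and
  \<open>x * lin3 x y z\<close> alone add up to \<open>z * lin2 x y\<close>. However,
  \<open>lin2 x (z * y)\<close> comes only together with \<open>lin2 (z * y) x\<close>. The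
  remaining summands cancel this companion, of multidegree (1,2,2) in \<open>x\<close>,
  \<open>y\<close>, \<open>z\<close>, at the price of terms of multidegree (1,1,3) that cancel among
  themselves.\<close>

lemma mult_lin2_in [intro]:
  assumes "x \<in> S" "y \<in> S" "z \<in> S" shows "z * lin2 x y \<in> I"
proof -
  \<comment> \<open>This certificate and those below were found by linear algebra over the two-element field.\<close>
  have "z * lin2 x y = (lin2 x (z * y) + lin2 (z * y) x) + lin3 x z (x * y) + lin3 x z (z * y * y)
      + lin3 y z (x * z * y) + lin3 y (x * z) (y * z) + lin3 z (x * z) (y * z) + lin3 z (z * x) (z * y)
      + lin3 y z (x * z) * z + (lin2 y z + lin2 z y) * (x * z) + z * z * z * (y * x) + x * lin3 x y z
      + x * lin3 y z (z * z) + x * (z * z * z) * y + z * lin3 y z (x * z) + z * (lin2 y z + lin2 z y) * x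
      + x * z * (lin2 y z + lin2 z y) + y * x * (z * z * z)"
    by (simp add: lin2_def lin3_def expand)
  also have "\<dots> \<in> I"
    using assms by (intro I_add lin3_in lin2_swap_in cube_in I_mult_left I_mult_right S_mult)
  finally show ?thesis .
qed

lemma lin2_mult_in [intro]:
  assumes "x \<in> S" "y \<in> S" "z \<in> S" shows "lin2 x y * z \<in> I"
proof -
  have "lin2 x y * z = lin3 x y (z * x) + lin3 x z (x * y) + y * lin2 x z"
    by (simp add: lin2_def lin3_def expand)
  also have "\<dots> \<in> I"
    using assms by (intro I_add lin3_in mult_lin2_in S_mult)
  finally show ?thesis .
qed

lemma lin2_product_in [intro]:
  assumes "x \<in> S" "y \<in> S" "z \<in> S" shows "lin2 x (y * z) \<in> I"
proof -
  have "lin2 x (y * z) = lin3 x z (y * x) + lin3 x y z * x + lin2 x y * z"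
    by (simp add: lin2_def lin3_def expand)
  also have "\<dots> \<in> I"
    using assms by (intro I_add lin3_in lin2_mult_in I_mult_right S_mult)
  finally show ?thesis .
qed

lemma three_squares_in:
  assumes "x \<in> S" "y \<in> S" "z \<in> S" shows "x * x * (y * y) * (z * z) \<in> I"
proof -
  have "x * x * (y * y) * (z * z) = lin2 x (z * z) * (y * y) + lin2 x (z * z * y * y)
      + lin2 z (x * y * y) * x + x * lin3 x (y * y) z * z + lin3 x (x * y * y * z) z
      + lin2 x z * (y * y * z) + z * z * lin2 x (y * y) + x * lin2 z (x * y * y) + x * lin2 z (y * y * x)"
    by (simp add: lin2_def lin3_def expand)
  also have "\<dots> \<in> I"
    using assms by (intro I_add lin3_in lin2_mult_in mult_lin2_in lin2_product_in I_mult_left I_mult_right S_mult)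
  finally show ?thesis .
qed

end

text \<open>Splitting at the first factor that belongs to \<open>K\<close> ensures that no other
  member of \<open>K\<close> is lost on its left. Iteration lists the members in the order in which
  a product contains them.\<close>

lemma subset_mset_split_first:
  assumes "K \<subseteq># mset ts" "K \<noteq> {#}"
  obtains U p W where "ts = U @ p # W" "p \<in># K" "K - {#p#} \<subseteq># mset W"
proof -
  have "\<exists>t\<in>set ts. t \<in># K"
    using assms by (metis mset_subset_eqD multiset_nonemptyE set_mset_mset)
  then obtain U p W where ts: "ts = U @ p # W" and p: "p \<in># K" and U: "\<forall>t\<in>set U. t \<notin># K"
    using split_list_first_prop[of ts "\<lambda>t. t \<in># K"] by metis
  have "count (K - {#p#}) t \<le> count (mset W) t" for t
  proof (cases "t \<in># K")
    case True
    then have "count (mset U) t = 0" using U by (auto simp: count_eq_zero_iff)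
    then have "count (mset ts) t = count (mset W) t + (if p = t then 1 else 0)"
      unfolding ts by simp
    then show ?thesis using mset_subset_eq_count[OF assms(1), of t] by (simp split: if_splits)
  qed (simp add: not_in_iff)
  then show ?thesis using that[OF ts p] by (simp add: subseteq_mset_def)
qed

section \<open>Merging repeated factors of long products\<close>

context nil_cube
begin

abbreviation S1 :: "'r set"
  where "S1 \<equiv> insert 1 S"

lemma I_mult_left1: "a \<in> S1 \<Longrightarrow> x \<in> I \<Longrightarrow> a * x \<in> I"
  and I_mult_right1: "x \<in> I \<Longrightarrow> a \<in> S1 \<Longrightarrow> x * a \<in> I"
  by auto

lemma I_sum: "p \<in> I \<Longrightarrow> q \<in> I \<Longrightarrow> x = p + q \<Longrightarrow> x \<in> I"
  by auto

lemma prod_list_in_S1: "set ts \<subseteq> S \<Longrightarrow> prod_list ts \<in> S1"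
  by (induction ts) auto

lemma prod_list_in_S: "set ts \<subseteq> S \<Longrightarrow> ts \<noteq> [] \<Longrightarrow> prod_list ts \<in> S"
  using prod_list_in_S1[of "tl ts"] by (cases ts) auto

text \<open>The members of \<open>K\<close> may stand in any order and with any gaps. The bound
  \<open>n\<close> counts factors rather than letters, because a merger of \<open>t\<close>,
  \<open>t\<close> into the single factor \<open>t * t\<close> has to lower it.\<close>

definition annihilates :: "nat \<Rightarrow> 'r multiset \<Rightarrow> bool"
  where "annihilates n K \<longleftrightarrow>
    (\<forall>ts. set ts \<subseteq> S \<and> K \<subseteq># mset ts \<and> n \<le> length ts \<longrightarrow> prod_list ts \<in> I)"

text \<open>
  Modulo \<open>I\<close>, in a nontrivial context, \<open>t a t = t\<^sup>2 a + a t\<^sup>2\<close>; hence two occurrences of \<open>t\<close> can be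
  merged into \<open>t\<^sup>2\<close>.
\<close>

lemma annihilates_double:
  assumes sq: "annihilates n (add_mset (t * t) K)" and t: "t \<in> S"
  shows "annihilates (max 4 (Suc n)) (add_mset t (add_mset t K))"
  unfolding annihilates_def
proof safe
  fix ts assume ts: "set ts \<subseteq> S" and K: "add_mset t (add_mset t K) \<subseteq># mset ts"
    and len: "max 4 (Suc n) \<le> length ts"
  have "{#t, t#} \<subseteq># mset ts"
    using subset_mset.order_trans[OF _ K, of "{#t, t#}"] by simp
  then obtain U W where ts1: "ts = U @ t # W" "{#t#} \<subseteq># mset W"
    by (rule subset_mset_split_first) auto
  then obtain A V where "W = A @ t # V"
    by (auto simp: in_set_conv_decomp)
  with ts1 have ts_eq: "ts = U @ t # A @ t # V" by simp
  then have K': "K \<subseteq># mset (U @ A @ V)" using K by simp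
  have sub: "set U \<subseteq> S" "set A \<subseteq> S" "set V \<subseteq> S" using ts ts_eq by auto
  have u: "prod_list U \<in> S1" and v: "prod_list V \<in> S1"
    using sub by (simp_all only: prod_list_in_S1)
  have in_I: "prod_list ts' \<in> I"
    if "set ts' \<subseteq> S" "mset ts' = add_mset (t * t) (mset (U @ A @ V))" for ts'
  proof -
    have "length ts' = Suc (length (U @ A @ V))" using arg_cong[OF that(2), of size] by simp
    moreover have "add_mset (t * t) K \<subseteq># mset ts'" using K' that(2) by simp
    ultimately show ?thesis using sq that(1) len ts_eq unfolding annihilates_def by auto
  qed
  show "prod_list ts \<in> I"
  proof (cases "A = []")
    case True
    then show ?thesis using in_I[of "U @ (t * t) # V"] t sub ts_eq by (simp add: mult.assoc)
  next
    case False
    define a where "a = prod_list A"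
    have a: "a \<in> S" using False sub by (auto simp: a_def intro: prod_list_in_S)
    have "prod_list U * (lin2 t a * prod_list V) \<in> I"
    proof -
      \<comment> \<open>Length at least 4 excludes the bare product of \<open>t\<close>, a single
        factor and \<open>t\<close>, for which \<open>lin2 t a\<close> need not lie in
        \<open>I\<close>.\<close>
      consider "U \<noteq> []" | "V \<noteq> []" | "length A \<ge> 2"
        using len ts_eq by (cases U; cases V) auto
      then show ?thesis
      proof cases
        case 1
        then have "prod_list U * lin2 t a \<in> I"
          using sub t a by (intro mult_lin2_in prod_list_in_S)
        then show ?thesis using I_mult_right1 v by (metis mult.assoc)
      next
        case 2
        then have "lin2 t a * prod_list V \<in> I"
          using sub t a by (intro lin2_mult_in prod_list_in_S)
        then show ?thesis using I_mult_left1 u by metis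
      next
        case 3
        then obtain p A' where A: "A = p # A'" "A' \<noteq> []" by (cases A) (auto simp: Suc_le_eq)
        then have "lin2 t a \<in> I" unfolding a_def
          using lin2_product_in[of t p "prod_list A'"] prod_list_in_S[of A'] sub t by auto
        then show ?thesis using I_mult_left1[OF u] I_mult_right1[OF _ v] by blast
      qed
    qed
    moreover have "prod_list (U @ (t * t) # A @ V) \<in> I" "prod_list (U @ A @ (t * t) # V) \<in> I"
      using sub t by (intro in_I; simp)+
    ultimately have "prod_list U * (lin2 t a * prod_list V) + prod_list (U @ (t * t) # A @ V)
        + prod_list (U @ A @ (t * t) # V) \<in> I"
      by (intro I_add)
    also have "prod_list U * (lin2 t a * prod_list V) + prod_list (U @ (t * t) # A @ V)
        + prod_list (U @ A @ (t * t) # V) = prod_list ts"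
      by (simp add: ts_eq lin2_def a_def expand)
    finally show ?thesis .
  qed
qed

lemma annihilates_mono: "annihilates n K \<Longrightarrow> n \<le> m \<Longrightarrow> annihilates m K"
  by (auto simp: annihilates_def)

text \<open>The linearization of a square is a commutator in characteristic 2. Hence a context that
  kills all squares allows \<open>x\<close> and \<open>a\<close> to be interchanged modulo
  \<open>I\<close>.\<close>

lemma polarize:
  assumes "\<And>z. z \<in> S \<Longrightarrow> u * (z * z) * v \<in> I" "x \<in> S" "a \<in> S"
  shows "u * (x * a + a * x) * v \<in> I"
proof -
  have "u * (x * a + a * x) * v
      = u * ((x + a) * (x + a)) * v + u * (x * x) * v + u * (a * a) * v"
    by (simp add: expand)
  also have "\<dots> \<in> I"
    using assms by (intro I_add) auto
  finally show ?thesis .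
qed

text \<open>Polarization carries the gaps past the squares until the three squares are
  adjacent.\<close>

lemma three_squares_in':
  assumes xyz: "x \<in> S" "y \<in> S" "z \<in> S" and a: "a \<in> S1" and b: "b \<in> S1"
  shows "x * x * a * (y * y) * b * (z * z) \<in> I"
proof -
  have *: "x * x * a * (y * y) * (z * z) \<in> I" if "x \<in> S" "y \<in> S" "z \<in> S" "a \<in> S1" for x y z a
  proof (cases "a = 1")
    case False
    then have "a \<in> S" using that by auto
    then have "1 * (x * x * a + a * (x * x)) * (y * y * (z * z)) \<in> I"
      using three_squares_in[of _ y z] that by (intro polarize) (auto simp: mult.assoc)
    moreover have "a * (x * x * (y * y) * (z * z)) \<in> I"
      using three_squares_in[of x y z] that \<open>a \<in> S\<close> by auto
    ultimately show ?thesis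
      by (rule I_sum) (simp add: expand)
  qed (use three_squares_in that in auto)
  show ?thesis
  proof (cases "b = 1")
    case True
    then show ?thesis using *[OF xyz a] by simp
  next
    case False
    then have b: "b \<in> S" using b by simp
    show ?thesis
    proof (cases "a = 1")
      case True
      have "x * x * (y * y) * (z * z * b + b * (z * z)) * 1 \<in> I"
        using three_squares_in[of x y] xyz b by (intro polarize) auto
      moreover have "x * x * (y * y) * (z * z) * b \<in> I"
        using three_squares_in[of x y z] xyz b by auto
      ultimately show ?thesis
        by (rule I_sum) (simp add: True expand)
    next
      case False
      then have a: "a \<in> S" using a by simp
      \<comment> \<open>Interchanging \<open>a\<close> with the whole block \<open>y * y * b\<close>
        fuses both gaps into the single gap \<open>b * a\<close>.\<close>
      have "x * x * (y * y * b * a + a * (y * y * b)) * (z * z) \<in> I"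
        using three_squares_in[of x _ z] xyz a b by (intro polarize) auto
      moreover have "x * x * (y * y) * (b * a) * (z * z) \<in> I"
      proof -
        have "x * x * (y * y) * (z * z * (b * a) + b * a * (z * z)) * 1 \<in> I"
          using three_squares_in[of x y] xyz a b by (intro polarize) auto
        moreover have "x * x * (y * y) * (z * z) * (b * a) \<in> I"
          using three_squares_in[of x y z] xyz a b by auto
        ultimately show ?thesis
          by (rule I_sum) (simp add: expand)
      qed
      ultimately show ?thesis
        by (rule I_sum) (simp add: expand)
    qed
  qed
qed

lemma in_context:
  assumes "x \<in> I" "set U \<subseteq> S" "set V \<subseteq> S"
  shows "prod_list U * (x * prod_list V) \<in> I"
  using assms I_mult_left1 I_mult_right1 prod_list_in_S1 by metis

lemma annihilates_three_squares:
  assumes "x \<in> S" "y \<in> S" "z \<in> S"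
  shows "annihilates 0 {#x * x, y * y, z * z#}"
  unfolding annihilates_def
proof safe
  fix ts assume ts: "set ts \<subseteq> S" and K: "{#x * x, y * y, z * z#} \<subseteq># mset ts"
  obtain U p W where 1: "ts = U @ p # W" "p \<in># {#x * x, y * y, z * z#}"
      "{#x * x, y * y, z * z#} - {#p#} \<subseteq># mset W"
    using K by (rule subset_mset_split_first) auto
  have size1: "size ({#x * x, y * y, z * z#} - {#p#}) = 2"
    unfolding size_Diff_singleton[OF 1(2)] by simp
  then have ne: "{#x * x, y * y, z * z#} - {#p#} \<noteq> {#}" by force
  obtain A q W' where 2: "W = A @ q # W'" "q \<in># {#x * x, y * y, z * z#} - {#p#}"
      "{#x * x, y * y, z * z#} - {#p#} - {#q#} \<subseteq># mset W'"
    using 1(3) ne by (rule subset_mset_split_first) auto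
  have "size ({#x * x, y * y, z * z#} - {#p#} - {#q#}) = 1"
    unfolding size_Diff_singleton[OF 2(2)] size1 by simp
  then have ne: "{#x * x, y * y, z * z#} - {#p#} - {#q#} \<noteq> {#}" by force
  obtain A' r V where 3: "W' = A' @ r # V" "r \<in># {#x * x, y * y, z * z#} - {#p#} - {#q#}"
    using 2(3) ne by (rule subset_mset_split_first) auto
  \<comment> \<open>As \<open>three_squares_in'\<close> holds for arbitrary squares, the six
    possible orders need not be distinguished.\<close>
  have sq: "\<exists>s\<in>S. t = s * s" if "t \<in># {#x * x, y * y, z * z#}" for t
    using that assms by auto
  obtain p' q' r' where "p = p' * p'" "q = q' * q'" "r = r' * r'" "p' \<in> S" "q' \<in> S" "r' \<in> S"
    using sq[of p] sq[of q] sq[of r] 1(2) 2(2) 3(2) by (meson in_diffD)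
  then have "p * prod_list A * q * prod_list A' * r \<in> I"
    using three_squares_in'[of p' q' r' "prod_list A" "prod_list A'"]
      prod_list_in_S1[of A] prod_list_in_S1[of A'] ts 1(1) 2(1) 3(1) by auto
  from in_context[OF this, of U V] show "prod_list ts \<in> I"
    using ts 1(1) 2(1) 3(1) by (simp add: mult.assoc)
qed

text \<open>The middle term of \<open>x * lin2 x a * x\<close> is
  \<open>x * x * a * (x * x)\<close>, and the two outer terms contain the cube of
  \<open>x\<close>.\<close>

lemma annihilates_square_square:
  assumes x: "x \<in> S"
  shows "annihilates 0 {#x * x, x * x#}"
  unfolding annihilates_def
proof safe
  fix ts assume ts: "set ts \<subseteq> S" and K: "{#x * x, x * x#} \<subseteq># mset ts"
  obtain U W where 1: "ts = U @ (x * x) # W" "{#x * x#} \<subseteq># mset W"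
    using K by (rule subset_mset_split_first) auto
  obtain A V where 2: "W = A @ (x * x) # V"
    using 1(2) by (rule subset_mset_split_first) auto
  have A: "prod_list A \<in> S1" using ts 1 2 by (intro prod_list_in_S1) auto
  have x3: "x * x * x \<in> I" using x by auto
  have "x * x * prod_list A * (x * x) \<in> I"
  proof (cases "prod_list A = 1")
    case True
    then show ?thesis using I_mult_right[OF x3 x] by (simp add: mult.assoc)
  next
    case False
    then have A: "prod_list A \<in> S" using A by simp
    have "x * x * prod_list A * (x * x) = x * lin2 x (prod_list A) * x + x * x * x * (prod_list A * x)
        + x * prod_list A * (x * x * x)"
      by (simp add: lin2_def expand)
    also have "\<dots> \<in> I" using x A
      by (intro I_add I_mult_right[OF mult_lin2_in] I_mult_right[OF x3] I_mult_left[OF _ x3] S_mult)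
    finally show ?thesis .
  qed
  from in_context[OF this, of U V] show "prod_list ts \<in> I"
    using ts 1(1) 2 by (simp add: mult.assoc)
qed

end

section \<open>Products containing \<open>x * x\<close>, \<open>x\<close> and
  \<open>y * y\<close>\<close>

context nil_cube
begin

text \<open>A third square would make the product vanish. Polarizing that square shows that two
  neighbouring factors commute modulo \<open>I\<close> once two squares stand elsewhere in the
  product.\<close>

lemma swap_in:
  assumes "x \<in> S" "y \<in> S" "z \<in> S" "a \<in> S" "set U \<subseteq> S" "set V \<subseteq> S"
    and "{#x * x, y * y#} \<subseteq># mset (U @ V)"
  shows "prod_list U * (z * a + a * z) * prod_list V \<in> I"
proof (rule polarize)
  fix t assume t: "t \<in> S"
  have eq: "mset (U @ (t * t) # V) = add_mset (t * t) (mset (U @ V))" by simp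
  have "{#t * t, x * x, y * y#} \<subseteq># mset (U @ (t * t) # V)"
    using assms(7) unfolding eq mset_subset_eq_add_mset_cancel .
  then have "prod_list (U @ (t * t) # V) \<in> I"
    using annihilates_three_squares[OF t assms(1,2)] assms(5,6) t
    unfolding annihilates_def by (metis S_mult Un_subset_iff insert_subset le0 list.set(2) set_append)
  then show "prod_list U * (t * t) * prod_list V \<in> I" by (simp add: mult.assoc)
qed (use assms in auto)

lemma square_letter_flip:
  assumes "x \<in> S" "w \<in> S"
  shows "x * x * w * x + x * w * (x * x) \<in> I"
proof -
  have "x * x * w * x + x * w * (x * x) = x * lin2 x w + x * x * x * w"
    by (simp add: lin2_def expand)
  also have "\<dots> \<in> I" using assms by (intro I_add mult_lin2_in I_mult_right cube_in)
  finally show ?thesis .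
qed

text \<open>As \<open>y * y\<close> does not stand between \<open>x * x\<close> and
  \<open>x\<close>, the letter \<open>x\<close> can be commuted through the gap \<open>a\<close>
  until a cube of \<open>x\<close> appears; the squares that permit this are \<open>x * x\<close>
  and \<open>y * y\<close> themselves.\<close>

lemma cube_square_adjacent:
  assumes "x \<in> S" "y \<in> S" "a \<in> S1" "b \<in> S1"
  shows "x * x * a * x * b * (y * y) \<in> I" "y * y * b * x * a * (x * x) \<in> I"
    and "x * a * (x * x) * b * (y * y) \<in> I" "y * y * b * (x * x) * a * x \<in> I"
proof -
  have x3: "x * x * x \<in> I" using assms by auto
  have b': "b * (y * y) \<in> S" "y * y * b \<in> S" using assms by auto
  show "x * x * a * x * b * (y * y) \<in> I"
  proof (cases "a = 1")
    case True
    then show ?thesis using I_mult_right[OF x3 b'(1)] by (simp add: mult.assoc)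
  next
    case False
    then have a: "a \<in> S" using assms by simp
    \<comment> \<open>\<open>swap_in\<close> asks for factors in \<open>S\<close>, so the gap
      \<open>b\<close> is listed only if it is not 1.\<close>
    have "prod_list [x * x] * (a * x + x * a) * prod_list (if b = 1 then [y * y] else [b, y * y]) \<in> I"
      using assms a by (intro swap_in[of x y]) auto
    moreover have "x * x * x * (a * b * (y * y)) \<in> I"
      using x3 a assms by (intro I_mult_right[OF x3]) auto
    ultimately show ?thesis
      by (rule I_sum) (simp add: expand)
  qed
  show "y * y * b * x * a * (x * x) \<in> I"
  proof (cases "a = 1")
    case True
    then show ?thesis using I_mult_left[OF b'(2) x3] by (simp add: mult.assoc)
  next
    case False
    then have a: "a \<in> S" using assms by simp
    have "prod_list (if b = 1 then [y * y] else [y * y, b]) * (a * x + x * a) * prod_list [x * x] \<in> I"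
      using assms a by (intro swap_in[of x y]) auto
    moreover have "y * y * b * a * (x * x * x) \<in> I"
      using x3 a assms by (intro I_mult_left[OF _ x3]) auto
    ultimately show ?thesis
      by (rule I_sum) (simp add: expand)
  qed
  show "x * a * (x * x) * b * (y * y) \<in> I"
  proof (cases "a = 1")
    case True
    then show ?thesis using I_mult_right[OF x3 b'(1)] by (simp add: mult.assoc)
  next
    case False
    then have a: "a \<in> S" using assms by simp
    have "prod_list [] * (a * x + x * a) * prod_list (if b = 1 then [x * x, y * y] else [x * x, b, y * y]) \<in> I"
      using assms a by (intro swap_in[of x y]) auto
    moreover have "a * (x * x * x * (b * (y * y))) \<in> I"
      using a I_mult_right[OF x3 b'(1)] by auto
    ultimately show ?thesis
      by (rule I_sum) (simp add: expand)
  qed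
  show "y * y * b * (x * x) * a * x \<in> I"
  proof (cases "a = 1")
    case True
    then show ?thesis using I_mult_left[OF b'(2) x3] by (simp add: mult.assoc)
  next
    case False
    then have a: "a \<in> S" using assms by simp
    have "prod_list (if b = 1 then [y * y, x * x] else [y * y, b, x * x]) * (a * x + x * a) * prod_list [] \<in> I"
      using assms a by (intro swap_in[of x y]) auto
    moreover have "y * y * b * (x * x * x) * a \<in> I"
      using a I_mult_left[OF b'(2) x3] by auto
    ultimately show ?thesis
      by (rule I_sum) (simp add: expand)
  qed
qed

text \<open>Here \<open>x\<close> would have to pass the very square \<open>y * y\<close> that
  permits the swaps. A nonempty gap is essential: for d = 2 the functional of
  \<open>compatible_factors11\<close> takes the value 1 on the word 11221.\<close>

lemma cube_square_separated_inner:
  assumes xy: "x \<in> S" "y \<in> S" and ab: "a \<in> S1" "b \<in> S1" "a \<in> S \<or> b \<in> S"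
  shows "x * x * a * (y * y) * b * x \<in> I"
proof -
  have x3: "x * x * x \<in> I" using xy by auto
  have left: "x * x * m * (y * y) * x \<in> I" if m: "m \<in> S" for m
  proof -
    \<comment> \<open>\<open>lin3 x (y * y) m\<close> contains the wanted arrangement. Its other
      five terms are disposed of by the cube of \<open>x\<close>, by \<open>swap_in\<close> and by
      \<open>cube_square_adjacent\<close>.\<close>
    have "x * x * m * (y * y) * x = x * x * lin3 x (y * y) m + x * x * x * (y * y * m + m * (y * y))
        + x * x * (y * y) * (x * m + m * x) + x * x * m * x * (y * y)"
      by (simp add: lin3_def expand)
    also have "\<dots> \<in> I"
      using x3 xy m swap_in[of x y x m "[x * x, y * y]" "[]"] cube_square_adjacent(1)[of x y m 1]
      by (intro I_add I_mult_left[OF _ lin3_in] I_mult_right[OF x3]) (auto simp: mult.assoc)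
    finally show ?thesis .
  qed
  have right: "x * x * (y * y) * m * x \<in> I" if m: "m \<in> S" for m
  proof -
    \<comment> \<open>Now \<open>lin3\<close> yields \<open>x * (y * y) * m * (x * x)\<close>, and
      \<open>square_letter_flip\<close> exchanges its ends.\<close>
    have "x * x * (y * y) * m * x = lin3 x (y * y) m * (x * x) + (x * m + m * x) * (y * y) * (x * x)
        + y * y * x * m * (x * x) + (y * y * m + m * (y * y)) * (x * x * x)
        + (x * x * (y * y * m) * x + x * (y * y * m) * (x * x))"
      by (simp add: lin3_def expand)
    also have "\<dots> \<in> I"
      using x3 xy m swap_in[of x y x m "[]" "[y * y, x * x]"] cube_square_adjacent(2)[of x y m 1]
      by (intro I_add I_mult_right[OF lin3_in] I_mult_left[OF _ x3] square_letter_flip) (auto simp: mult.assoc)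
    finally show ?thesis .
  qed
  show ?thesis
  proof (cases "a \<in> S")
    case False
    then show ?thesis using right[of b] ab by (simp add: mult.assoc)
  next
    case a: True
    show ?thesis
    proof (cases "b \<in> S")
      case False
      then show ?thesis using left[OF a] ab by (simp add: mult.assoc)
    next
      case b: True
      have "prod_list [x * x, a, y * y] * (b * x + x * b) * prod_list [] \<in> I"
        using xy a b by (intro swap_in[of x y]) auto
      moreover have "x * x * a * (y * y) * x * b \<in> I"
        using left[OF a] b by auto
      ultimately show ?thesis
        by (rule I_sum) (simp add: expand)
    qed
  qed
qed

lemma cube_square_separated:
  assumes xy: "x \<in> S" "y \<in> S" and ab: "a \<in> S1" "b \<in> S1" and uv: "u \<in> S1" "v \<in> S1"
    and nontrivial: "a \<in> S \<or> b \<in> S \<or> u \<in> S \<or> v \<in> S"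
  shows "u * (x * x * a * (y * y) * b * x) * v \<in> I" "u * (x * a * (y * y) * b * (x * x)) * v \<in> I"
proof -
  have x2y2x: "x * x * (y * y) * x * m \<in> I" if m: "m \<in> S" for m
  proof -
    have "prod_list [x * x, y * y] * (x * m + m * x) * prod_list [] \<in> I"
      using xy m by (intro swap_in[of x y]) auto
    moreover have "x * x * 1 * (y * y) * m * x \<in> I"
      using xy m by (intro cube_square_separated_inner) auto
    ultimately show ?thesis
      by (rule I_sum) (simp add: expand)
  qed
  \<comment> \<open>Flipping the ends, interchanging \<open>m\<close> with the leading
    \<open>x\<close> and flipping back puts \<open>m\<close> between \<open>x * x\<close> and
    \<open>y * y\<close>, where the inner case applies.\<close>
  have mx2y2x: "m * (x * x * (y * y) * x) \<in> I" if m: "m \<in> S" for m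
  proof -
    have "prod_list [] * (x * m + m * x) * prod_list [y * y, x * x] \<in> I"
      using xy m by (intro swap_in[of x y]) auto
    moreover have "m * (x * x * (y * y) * x + x * (y * y) * (x * x)) \<in> I"
      using xy m square_letter_flip[of x "y * y"] by auto
    moreover have "x * x * (m * (y * y)) * x + x * (m * (y * y)) * (x * x) \<in> I"
      using xy m square_letter_flip[of x "m * (y * y)"] by auto
    moreover have "x * x * m * (y * y) * 1 * x \<in> I"
      using xy m by (intro cube_square_separated_inner) auto
    ultimately have "prod_list [] * (x * m + m * x) * prod_list [y * y, x * x]
        + m * (x * x * (y * y) * x + x * (y * y) * (x * x))
        + (x * x * (m * (y * y)) * x + x * (m * (y * y)) * (x * x)) + x * x * m * (y * y) * 1 * x \<in> I"
      by (rule I_add[OF I_add[OF I_add]])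
    then show ?thesis by (simp add: expand)
  qed
  show *: "u * (x * x * a * (y * y) * b * x) * v \<in> I"
  proof (cases "a \<in> S \<or> b \<in> S")
    case True
    then show ?thesis using cube_square_separated_inner[OF xy ab] uv I_mult_left1 I_mult_right1 by blast
  next
    case False
    then have ab1: "a = 1" "b = 1" using ab by auto
    show ?thesis
    proof (cases "u \<in> S")
      case True
      then have "u * (x * x * (y * y) * x) \<in> I" using mx2y2x by blast
      then show ?thesis using I_mult_right1[OF _ uv(2)] ab1 by simp
    next
      case u: False
      then have "v \<in> S" using False nontrivial by auto
      then show ?thesis using x2y2x[of v] ab1 u uv by simp
    qed
  qed
  have "a * (y * y) * b \<in> S" using xy ab by auto
  from square_letter_flip[OF xy(1) this]
  have "u * (x * x * (a * (y * y) * b) * x + x * (a * (y * y) * b) * (x * x)) * v \<in> I"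
    using uv I_mult_left1 I_mult_right1 by blast
  from this * show "u * (x * a * (y * y) * b * (x * x)) * v \<in> I"
    by (rule I_sum) (simp add: expand)
qed

text \<open>The bound 4 excludes the bare products of the three marked factors; of these,
  \<open>x * x * (y * y) * x\<close> need not lie in \<open>I\<close>.\<close>

lemma annihilates_square_letter_square:
  assumes x: "x \<in> S" and y: "y \<in> S"
  shows "annihilates 4 {#x * x, x, y * y#}"
  unfolding annihilates_def
proof safe
  let ?K = "{#x * x, x, y * y#}"
  fix ts assume ts: "set ts \<subseteq> S" and K: "?K \<subseteq># mset ts" and len: "4 \<le> length ts"
  obtain U p W where 1: "ts = U @ p # W" "p \<in># ?K" "?K - {#p#} \<subseteq># mset W"
    using K by (rule subset_mset_split_first) auto
  have size1: "size (?K - {#p#}) = 2"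
    unfolding size_Diff_singleton[OF 1(2)] by simp
  then have ne: "?K - {#p#} \<noteq> {#}" by force
  obtain A q W' where 2: "W = A @ q # W'" "q \<in># ?K - {#p#}" "?K - {#p#} - {#q#} \<subseteq># mset W'"
    using 1(3) ne by (rule subset_mset_split_first) auto
  have "size (?K - {#p#} - {#q#}) = 1"
    unfolding size_Diff_singleton[OF 2(2)] size1 by simp
  then obtain r where r: "?K - {#p#} - {#q#} = {#r#}" using size_1_singleton_mset by blast
  with 2(3) have "r \<in> set W'" by simp
  then obtain A' V where 3: "W' = A' @ r # V" by (meson split_list)
  have "?K = {#p, q, r#}"
    using r 1(2) 2(2) by (metis add_mset_commute insert_DiffM)
  then have pqr: "(p, q, r) \<in> {(x * x, x, y * y), (x * x, y * y, x), (x, x * x, y * y),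
      (x, y * y, x * x), (y * y, x * x, x), (y * y, x, x * x)}"
    by (auto simp: add_eq_conv_ex)
  define u a b v where "u = prod_list U" "a = prod_list A" "b = prod_list A'" "v = prod_list V"
  note uabv_def = this
  have uabv: "u \<in> S1" "a \<in> S1" "b \<in> S1" "v \<in> S1"
    using ts 1(1) 2(1) 3 unfolding uabv_def by (simp_all only: prod_list_in_S1 set_append list.set Un_subset_iff insert_subset)
  have prod_ts: "prod_list ts = u * (p * a * q * b * r) * v"
    by (simp add: 1(1) 2(1) 3 uabv_def mult.assoc)
  show "prod_list ts \<in> I"
  proof -
    consider "p = x * x \<and> q = y * y \<and> r = x \<or> p = x \<and> q = y * y \<and> r = x * x"
      | "p * a * q * b * r \<in> I"
      using pqr cube_square_adjacent[OF x y uabv(2,3)] cube_square_adjacent[OF x y uabv(3,2)] by auto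
    then show ?thesis
    proof cases
      case 1
      have "U \<noteq> [] \<or> A \<noteq> [] \<or> A' \<noteq> [] \<or> V \<noteq> []"
        using len by (auto simp: \<open>ts = U @ p # W\<close> 2(1) 3)
      then have "a \<in> S \<or> b \<in> S \<or> u \<in> S \<or> v \<in> S"
        using ts unfolding uabv_def \<open>ts = U @ p # W\<close> 2(1) 3 by (auto intro!: prod_list_in_S)
      then show ?thesis
        using 1 cube_square_separated[OF x y uabv(2,3,1,4)] unfolding prod_ts by auto
    next
      case 2
      then show ?thesis unfolding prod_ts using uabv I_mult_left1 I_mult_right1 by blast
    qed
  qed
qed

text \<open>The first merger raises the bound from 0 to the minimum 4 of
  \<open>annihilates_double\<close>, the other two to 5 and 6.\<close>

lemma annihilates_2_2_2:
  assumes "x \<in> S" "y \<in> S" "z \<in> S"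
  shows "annihilates 6 {#x, x, y, y, z, z#}"
proof -
  have "annihilates 4 {#x, x, y * y, z * z#}"
    using annihilates_double[OF annihilates_three_squares[OF assms] assms(1)] by simp
  then have "annihilates 4 (add_mset (y * y) {#x, x, z * z#})"
    by (simp add: add_mset_commute)
  from annihilates_double[OF this assms(2)]
  have "annihilates 5 (add_mset (z * z) {#x, x, y, y#})"
    by (simp add: add_mset_commute)
  from annihilates_double[OF this assms(3)]
  have "annihilates 6 (add_mset z (add_mset z {#x, x, y, y#}))" by simp
  also have "add_mset z (add_mset z {#x, x, y, y#}) = {#x, x, y, y, z, z#}"
    by (simp add: add_mset_commute)
  finally show ?thesis .
qed

lemma annihilates_4:
  assumes "x \<in> S"
  shows "annihilates 6 {#x, x, x, x#}"
proof -
  have "annihilates 4 {#x, x, x * x#}"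
    using annihilates_double[OF annihilates_square_square[OF assms] assms] by simp
  then have "annihilates 4 (add_mset (x * x) {#x, x#})"
    by (simp add: add_mset_commute)
  from annihilates_double[OF this assms] show ?thesis
    by (auto intro: annihilates_mono)
qed

text \<open>Only two of the three \<open>x\<close> are merged; the third is the single letter of
  \<open>annihilates_square_letter_square\<close>. Two mergers raise its bound 4 to 6.\<close>

lemma annihilates_3_2:
  assumes "x \<in> S" "y \<in> S"
  shows "annihilates 6 {#x, x, x, y, y#}"
proof -
  have "annihilates 4 (add_mset (y * y) {#x * x, x#})"
    using annihilates_square_letter_square[OF assms] by (simp add: add_mset_commute)
  from annihilates_double[OF this assms(2)]
  have "annihilates 5 (add_mset (x * x) {#x, y, y#})"
    by (simp add: add_mset_commute)
  from annihilates_double[OF this assms(1)] show ?thesis by simp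
qed

end

subsection \<open>The free algebra and its ideals\<close>

abbreviation scale :: "'k::field \<Rightarrow> 'k nc_poly \<Rightarrow> 'k nc_poly"
  where "scale c \<equiv> Poly_Mapping.map ((*) c)"

abbreviation mon :: "nat list \<Rightarrow> 'k::field nc_poly"
  where "mon w \<equiv> Poly_Mapping.single (Word w) 1"

abbreviation words :: "nat \<Rightarrow> nat list set"
  where "words d \<equiv> {w. w \<noteq> [] \<and> set w \<subseteq> {1..d}}"

abbreviation polys :: "nat \<Rightarrow> 'k::field nc_poly set"
  where "polys d \<equiv> carrier (free_alg d)"

lemma scale_simps:
  "scale c (p + q) = scale c p + scale c q" "scale (a + b) p = scale a p + scale b p"
  "scale a (scale b p) = scale (a * b) p" "scale 1 p = p" "scale 0 p = 0" "scale c 0 = 0"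
  "scale c (Poly_Mapping.single w a) = Poly_Mapping.single w (c * a)"
  by (auto intro!: poly_mapping_eqI simp: lookup_smult lookup_add lookup_single when_def algebra_simps)

lemma scale_diff: "scale c (p - q) = scale c p - scale c q"
  by (rule poly_mapping_eqI) (simp add: lookup_smult lookup_minus right_diff_distrib)

lemma scale_sum: "scale c (sum g A) = (\<Sum>i\<in>A. scale c (g i))"
  by (induction A rule: infinite_finite_induct) (simp_all add: scale_simps)

lemma sum_single_lookup: "(\<Sum>w\<in>Poly_Mapping.keys p. Poly_Mapping.single w (Poly_Mapping.lookup p w)) = p"
  by (rule poly_mapping_eqI)
    (auto simp: lookup_sum lookup_single when_def in_keys_iff)

lemma scale_mult_left: "scale c (p * q) = scale c p * q"
  by (simp add: mult_map_scale_conv_mult mult.assoc)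

text \<open>Words do not commute, but scalars are multiples of the empty word and hence
  central.\<close>

lemma scale_mult_right: "scale c (p * q) = p * scale c q"
proof -
  have "Poly_Mapping.single 0 c * (\<Sum>w\<in>Poly_Mapping.keys p. Poly_Mapping.single w (Poly_Mapping.lookup p w))
      = (\<Sum>w\<in>Poly_Mapping.keys p. Poly_Mapping.single w (Poly_Mapping.lookup p w)) * Poly_Mapping.single 0 c"
    by (simp add: sum_distrib_left sum_distrib_right mult_single mult.commute)
  then have "Poly_Mapping.single 0 c * p = p * Poly_Mapping.single 0 c"
    by (simp add: sum_single_lookup)
  then show ?thesis by (simp add: mult_map_scale_conv_mult flip: mult.assoc)
qed

lemma scale_minus_1: "scale (- 1) p = - p"
  by (rule poly_mapping_eqI) (simp add: lookup_smult)

lemma mon_mult: "mon u * mon v = mon (u @ v)"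
  by (simp add: mult_single plus_fword_def)

lemma polys_iff: "p \<in> polys d \<longleftrightarrow> (\<forall>w\<in>Poly_Mapping.keys p. letters w \<in> words d)"
  by (simp add: free_alg_def)

lemma free_alg_simps [simp]:
  "x \<otimes>\<^bsub>free_alg d\<^esub> y = x * y" "x \<oplus>\<^bsub>free_alg d\<^esub> y = x + y" "\<zero>\<^bsub>free_alg d\<^esub> = 0"
  "c \<odot>\<^bsub>free_alg d\<^esub> x = scale c x"
  by (simp_all add: free_alg_def)

lemma polys_closed [intro, simp]:
  shows "0 \<in> polys d"
    and "p \<in> polys d \<Longrightarrow> q \<in> polys d \<Longrightarrow> p + q \<in> polys d"
    and "p \<in> polys d \<Longrightarrow> q \<in> polys d \<Longrightarrow> p * q \<in> polys d"
    and "p \<in> polys d \<Longrightarrow> scale c p \<in> polys d"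
    and "w \<in> words d \<Longrightarrow> Poly_Mapping.single (Word w) a \<in> polys d"
proof -
  show "p \<in> polys d \<Longrightarrow> q \<in> polys d \<Longrightarrow> p + q \<in> polys d"
    using keys_add[of p q] by (auto simp: polys_iff)
  show "p \<in> polys d \<Longrightarrow> q \<in> polys d \<Longrightarrow> p * q \<in> polys d"
    using free_alg_mult_closed[of p d q] by simp
qed (auto simp: polys_iff in_keys_iff lookup_smult)

lemma polys_sum: "(\<And>i. i \<in> A \<Longrightarrow> f i \<in> polys d) \<Longrightarrow> sum f A \<in> polys d"
  by (induction A rule: infinite_finite_induct) auto

lemma polys_induct [consumes 1, case_names zero single add]:
  assumes "p \<in> polys d" and "P 0"
    and single: "\<And>c w. w \<in> words d \<Longrightarrow> P (Poly_Mapping.single (Word w) c)"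
    and add: "\<And>p q. p \<in> polys d \<Longrightarrow> q \<in> polys d \<Longrightarrow> P p \<Longrightarrow> P q \<Longrightarrow> P (p + q)"
  shows "P p"
proof -
  have "P (\<Sum>w\<in>A. Poly_Mapping.single w (Poly_Mapping.lookup p w))" if "finite A" "A \<subseteq> Poly_Mapping.keys p" for A
    using that
  proof (induction A rule: finite_induct)
    case (insert w A)
    from insert.prems assms(1) have w: "letters w \<in> words d" by (auto simp: polys_iff)
    have "(\<Sum>w\<in>A. Poly_Mapping.single w (Poly_Mapping.lookup p w)) \<in> polys d"
    proof (rule polys_sum)
      fix v assume "v \<in> A"
      then have "letters v \<in> words d" using insert.prems assms(1) by (auto simp: polys_iff)
      then show "Poly_Mapping.single v (Poly_Mapping.lookup p v) \<in> polys d"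
        using polys_closed(5)[of "letters v" d] by simp
    qed
    moreover have "P (Poly_Mapping.single w c)" "Poly_Mapping.single w c \<in> polys d" for c
      using single[OF w, of c] polys_closed(5)[OF w, of c] by simp_all
    ultimately show ?case
      unfolding sum.insert[OF insert.hyps] using insert.IH insert.prems by (intro add) auto
  qed (simp add: assms(2))
  from this[OF finite_keys order.refl] show ?thesis by (simp add: sum_single_lookup)
qed

lemma alg_ideal_iff:
  fixes I :: "'k::field nc_poly set"
  shows "alg_ideal (free_alg d) I \<longleftrightarrow> I \<subseteq> polys d \<and> 0 \<in> I \<and> (\<forall>x\<in>I. \<forall>y\<in>I. x + y \<in> I)
    \<and> (\<forall>c. \<forall>x\<in>I. scale c x \<in> I) \<and> (\<forall>x\<in>I. \<forall>a\<in>polys d. a * x \<in> I \<and> x * a \<in> I)"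
proof -
  interpret Module.module "class_ring :: 'k ring" "free_alg d :: ('k, _) module"
    by (rule module_free_alg)
  have "Module.submodule I (class_ring :: 'k ring) (free_alg d) \<longleftrightarrow>
    I \<subseteq> polys d \<and> 0 \<in> I \<and> (\<forall>x\<in>I. \<forall>y\<in>I. x + y \<in> I) \<and> (\<forall>c. \<forall>x\<in>I. scale c x \<in> I)"
    (is "?L \<longleftrightarrow> ?R")
  proof
    assume L: ?L
    have "\<forall>x\<in>I. \<forall>y\<in>I. x + y \<in> I" using submoduleE(5)[OF L] by simp
    moreover have sc: "\<forall>c. \<forall>x\<in>I. scale c x \<in> I" using submoduleE(4)[OF L] by simp
    moreover obtain x where "x \<in> I" using submoduleE(2)[OF L] by blast
    then have "0 \<in> I" using sc by (metis scale_simps(5))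
    ultimately show ?R using submoduleE(1)[OF L] by blast
  next
    assume R: ?R
    show ?L
    proof (rule submoduleI)
      fix x assume x: "x \<in> I"
      then have "x \<in> polys d" using R by blast
      moreover have "- x \<in> I" using R x by (metis scale_minus_1)
      then have "- x \<in> polys d" using R by blast
      ultimately have "\<ominus>\<^bsub>free_alg d\<^esub> x = - x"
        by (intro M.minus_equality) auto
      then show "\<ominus>\<^bsub>free_alg d\<^esub> x \<in> I" using \<open>- x \<in> I\<close> by simp
    qed (use R in auto)
  qed
  then show ?thesis unfolding alg_ideal_def by simp
qed

lemma ideal_closed:
  assumes "alg_ideal (free_alg d) (I :: 'k::field nc_poly set)"
  shows "I \<subseteq> polys d" "0 \<in> I" "x \<in> I \<Longrightarrow> y \<in> I \<Longrightarrow> x + y \<in> I" "x \<in> I \<Longrightarrow> scale c x \<in> I"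
    "x \<in> I \<Longrightarrow> a \<in> polys d \<Longrightarrow> a * x \<in> I" "x \<in> I \<Longrightarrow> a \<in> polys d \<Longrightarrow> x * a \<in> I"
  using assms unfolding alg_ideal_iff by blast+

lemma gen_ideal_least: "alg_ideal A I \<Longrightarrow> S \<subseteq> I \<Longrightarrow> gen_ideal A S \<subseteq> I"
  by (auto simp: gen_ideal_def)

lemma gen_ideal_superset: "S \<subseteq> gen_ideal A S"
  by (auto simp: gen_ideal_def)

lemma alg_ideal_sum:
  "alg_ideal (free_alg d) I \<Longrightarrow> (\<And>i. i \<in> A \<Longrightarrow> f i \<in> I) \<Longrightarrow> sum f A \<in> I"
  by (induction A rule: infinite_finite_induct) (auto simp: alg_ideal_iff)

lemma alg_ideal_minus:
  "alg_ideal (free_alg d) I \<Longrightarrow> x \<in> I \<Longrightarrow> - x \<in> I"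
  "alg_ideal (free_alg d) I \<Longrightarrow> x \<in> I \<Longrightarrow> y \<in> I \<Longrightarrow> x - y \<in> I"
proof -
  show *: "alg_ideal (free_alg d) I \<Longrightarrow> x \<in> I \<Longrightarrow> - x \<in> I" for x
    unfolding alg_ideal_iff by (metis scale_minus_1)
  show "alg_ideal (free_alg d) I \<Longrightarrow> x \<in> I \<Longrightarrow> y \<in> I \<Longrightarrow> x - y \<in> I"
    using *[of y] unfolding alg_ideal_iff by (metis add_uminus_conv_diff)
qed

subsection \<open>Quotient algebras\<close>

context
  fixes d :: nat and I :: "'k::field nc_poly set"
  assumes I: "alg_ideal (free_alg d) I"
begin

abbreviation "coset p \<equiv> I +>\<^bsub>free_alg d\<^esub> p"
abbreviation "quot \<equiv> quot_alg (free_alg d) I"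

lemma coset_eq: "coset p = (\<lambda>i. i + p) ` I"
  by (auto simp: a_r_coset_def')

lemma coset_eq_iff: "coset p = coset q \<longleftrightarrow> p - q \<in> I"
proof
  assume "coset p = coset q"
  moreover have "p \<in> coset p" using I by (force simp: coset_eq alg_ideal_iff)
  ultimately show "p - q \<in> I" by (auto simp: coset_eq)
next
  have sub: "coset p \<subseteq> coset q" if pq: "p - q \<in> I" for p q
  proof
    fix x assume "x \<in> coset p"
    then obtain i where i: "i \<in> I" "x = i + p" by (auto simp: coset_eq)
    then have "i + (p - q) \<in> I" "x = i + (p - q) + q" using I pq by (auto simp: alg_ideal_iff)
    then show "x \<in> coset q" unfolding coset_eq by blast
  qed
  assume "p - q \<in> I"
  with sub[of p q] sub[of q p] alg_ideal_minus(1)[OF I, of "p - q"] show "coset p = coset q" by auto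
qed

lemma zero_coset: "\<zero>\<^bsub>quot\<^esub> = coset 0"
  by (simp add: quot_alg_def coset_eq)

lemma carrier_quot: "carrier quot = coset ` polys d"
  by (auto simp: quot_alg_def A_RCOSETS_def')

lemma add_coset: "coset p \<oplus>\<^bsub>quot\<^esub> coset q = coset (p + q)"
proof -
  have "(\<Union>x\<in>coset p. \<Union>y\<in>coset q. {x + y}) = coset (p + q)" (is "?L = ?R")
  proof
    show "?L \<subseteq> ?R"
    proof safe
      fix x y assume "x \<in> coset p" "y \<in> coset q"
      then obtain i j where "i \<in> I" "j \<in> I" "x = i + p" "y = j + q" by (auto simp: coset_eq)
      then have "i + j \<in> I" "x + y = i + j + (p + q)" using I by (auto simp: alg_ideal_iff)
      then show "x + y \<in> ?R" unfolding coset_eq by blast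
    qed
    show "?R \<subseteq> ?L"
    proof
      fix x assume "x \<in> ?R"
      then obtain i where i: "i \<in> I" "x = (i + p) + (0 + q)" by (auto simp: coset_eq)
      moreover have "0 \<in> I" using I by (simp add: alg_ideal_iff)
      ultimately show "x \<in> ?L" unfolding coset_eq by blast
    qed
  qed
  then show ?thesis by (simp add: quot_alg_def set_add_def')
qed

lemma scale_coset: "c \<odot>\<^bsub>quot\<^esub> coset p = coset (scale c p)"
proof -
  have eq: "coset (scale c x) = coset (scale c p)" if "x \<in> coset p" for x
  proof -
    from that obtain i where "i \<in> I" "x = i + p" by (auto simp: coset_eq)
    then have "scale c x - scale c p \<in> I" using I by (auto simp: alg_ideal_iff scale_simps)
    then show ?thesis by (simp add: coset_eq_iff)
  qed
  have "p \<in> coset p" using I by (force simp: coset_eq alg_ideal_iff)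
  then have "coset p \<noteq> {}" by blast
  then have "(\<Union>x\<in>coset p. coset (scale c x)) = coset (scale c p)"
    by (rule SUP_eq_const) (rule eq)
  then show ?thesis by (simp add: quot_alg_def)
qed

lemma list_mult_coset:
  assumes "ps \<noteq> []" "set ps \<subseteq> polys d"
  shows "list_mult quot (map coset ps) = coset (prod_list ps)"
proof -
  have "foldl (monoid.mult quot) (coset p) (map coset ps) = coset (p * prod_list ps)"
    if "p \<in> polys d" "set ps \<subseteq> polys d" for p ps
    using that by (induction ps arbitrary: p) (auto simp: quot_alg_mult[OF I] mult.assoc)
  then show ?thesis using assms by (cases ps) (auto simp: list_mult_def)
qed

lemma list_mult_coset_eq_zero_iff:
  assumes "ps \<noteq> []" "set ps \<subseteq> polys d"
  shows "list_mult quot (map coset ps) = \<zero>\<^bsub>quot\<^esub> \<longleftrightarrow> prod_list ps \<in> I"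
  by (simp add: list_mult_coset[OF assms] zero_coset coset_eq_iff)

text \<open>If all products of a smaller length vanished, so would a prefix of \<open>ps\<close>,
  and with it the whole product.\<close>

lemma nilpotency_degree_quot:
  assumes "\<And>ps. length ps = n \<Longrightarrow> set ps \<subseteq> polys d \<Longrightarrow> prod_list ps \<in> I"
    and ps: "Suc (length ps) = n" "set ps \<subseteq> polys d" "prod_list ps \<notin> I" and n: "2 \<le> n"
  shows "nilpotency_degree quot = n"
  unfolding nilpotency_degree_def
proof (rule cInf_eq_minimum)
  show "n \<in> {c. 0 < c \<and> (\<forall>as. length as = c \<and> set as \<subseteq> carrier quot \<longrightarrow> list_mult quot as = \<zero>\<^bsub>quot\<^esub>)}"
  proof (intro CollectI conjI allI impI)
    fix as assume as: "length as = n \<and> set as \<subseteq> carrier quot"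
    then have "as \<in> lists (coset ` polys d)" by (auto simp: carrier_quot)
    then obtain ps where ps: "as = map coset ps" "set ps \<subseteq> polys d"
      unfolding lists_image by auto
    then show "list_mult quot as = \<zero>\<^bsub>quot\<^esub>"
      using list_mult_coset_eq_zero_iff[of ps] assms(1)[of ps] as n by fastforce
  qed (use n in simp)
next
  fix c assume "c \<in> {c. 0 < c \<and> (\<forall>as. length as = c \<and> set as \<subseteq> carrier quot \<longrightarrow> list_mult quot as = \<zero>\<^bsub>quot\<^esub>)}"
  then have c: "0 < c" and zero: "\<And>as. length as = c \<Longrightarrow> set as \<subseteq> carrier quot \<Longrightarrow> list_mult quot as = \<zero>\<^bsub>quot\<^esub>"
    by auto
  show "n \<le> c"
  proof (rule ccontr)
    assume "\<not> n \<le> c"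
    define qs where "qs = take c ps"
    have qs: "length qs = c" "set qs \<subseteq> polys d" "qs \<noteq> []"
      using \<open>\<not> n \<le> c\<close> c ps set_take_subset[of c ps] by (auto simp: qs_def)
    moreover have "list_mult quot (map coset qs) = \<zero>\<^bsub>quot\<^esub>"
      using qs by (intro zero) (auto simp: carrier_quot)
    ultimately have "prod_list qs \<in> I" using list_mult_coset_eq_zero_iff by blast
    moreover have "prod_list (qs @ rs) \<in> I" if "prod_list qs \<in> I" "set rs \<subseteq> polys d" for rs
      using that
    proof (induction rs rule: rev_induct)
      case (snoc r rs)
      then show ?case using I by (simp add: alg_ideal_iff flip: mult.assoc)
    qed simp
    ultimately have "prod_list (qs @ drop c ps) \<in> I" using ps set_drop_subset[of c ps] by blast
    then show False using ps(3) by (simp add: qs_def)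
  qed
qed

text \<open>Basis and dimension are expressed by representatives modulo \<open>I\<close>. The index
  type is arbitrary so that a disjoint sum of words and pairs can index a basis later.\<close>

lemma dim_quot:
  fixes e :: "'i \<Rightarrow> 'k nc_poly"
  assumes fin: "finite X" and e: "\<And>i. i \<in> X \<Longrightarrow> e i \<in> polys d"
    and span: "\<And>p. p \<in> polys d \<Longrightarrow> \<exists>c. p - (\<Sum>i\<in>X. scale (c i) (e i)) \<in> I"
    and indep: "\<And>c. (\<Sum>i\<in>X. scale (c i) (e i)) \<in> I \<Longrightarrow> \<forall>i\<in>X. c i = 0"
  shows "alg_fin_dim quot" "alg_dim quot = card X"
proof -
  interpret V: vectorspace "class_ring :: 'k ring" quot
    by (intro vectorspace_quot_alg module_free_alg I)
  let ?f = "\<lambda>i. coset (e i)"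
  have inj: "inj_on ?f X"
  proof (rule inj_onI, rule ccontr)
    fix i j assume ij: "i \<in> X" "j \<in> X" "?f i = ?f j" "i \<noteq> j"
    \<comment> \<open>Two indices with equal cosets would give a relation with the coefficients 1
      and -1.\<close>
    define c :: "'i \<Rightarrow> 'k" where "c = (\<lambda>k. if k = i then 1 else if k = j then - 1 else 0)"
    have "(\<Sum>k\<in>X. scale (c k) (e k)) = (\<Sum>k\<in>{i, j}. scale (c k) (e k))"
      using fin ij by (intro sum.mono_neutral_right) (auto simp: c_def scale_simps)
    also have "\<dots> = e i - e j" using ij by (simp add: c_def scale_simps scale_minus_1)
    also have "\<dots> \<in> I" using ij by (simp add: coset_eq_iff)
    finally show False using indep[of c] ij(1) by (auto simp: c_def)
  qed
  have sum_coset: "(\<Oplus>\<^bsub>quot\<^esub>i\<in>Y. c i \<odot>\<^bsub>quot\<^esub> ?f i) = coset (\<Sum>i\<in>Y. scale (c i) (e i))"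
    if "Y \<subseteq> X" for Y c
    using finite_subset[OF that fin] that
  proof (induction Y rule: finite_induct)
    case empty
    then show ?case by (simp add: zero_coset)
  next
    case (insert i Y)
    then have "(\<lambda>i. c i \<odot>\<^bsub>quot\<^esub> ?f i) \<in> Y \<rightarrow> carrier quot" "c i \<odot>\<^bsub>quot\<^esub> ?f i \<in> carrier quot"
      using e by (auto simp: scale_coset carrier_quot)
    then show ?case using insert by (simp add: V.finsum_insert add_coset scale_coset)
  qed
  have lincomb: "V.lincomb a (?f ` X) = coset (\<Sum>i\<in>X. scale (a (?f i)) (e i))" for a
  proof -
    have "(\<lambda>v. a v \<odot>\<^bsub>quot\<^esub> v) \<in> ?f ` X \<rightarrow> carrier quot"
      using e by (auto simp: scale_coset carrier_quot)
    then have "V.lincomb a (?f ` X) = (\<Oplus>\<^bsub>quot\<^esub>i\<in>X. a (?f i) \<odot>\<^bsub>quot\<^esub> ?f i)"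
      unfolding V.lincomb_def by (rule V.finsum_reindex[OF _ inj])
    then show ?thesis using sum_coset[of X "\<lambda>i. a (?f i)"] by simp
  qed
  have sub: "?f ` X \<subseteq> carrier quot" using e by (auto simp: carrier_quot)
  have "V.lin_indpt (?f ` X)"
  proof (rule V.finite_lin_indpt2)
    fix a assume "V.lincomb a (?f ` X) = \<zero>\<^bsub>quot\<^esub>"
    then have "(\<Sum>i\<in>X. scale (a (?f i)) (e i)) \<in> I"
      by (simp add: lincomb zero_coset coset_eq_iff)
    from indep[OF this] show "\<forall>v\<in>?f ` X. a v = \<zero>\<^bsub>class_ring\<^esub>" by simp
  qed (use fin sub in auto)
  moreover have gen: "V.span (?f ` X) = carrier quot"
  proof
    show "V.span (?f ` X) \<subseteq> carrier quot" using sub by (rule V.span_is_subset2)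
    show "carrier quot \<subseteq> V.span (?f ` X)"
    proof
      fix v assume "v \<in> carrier quot"
      then obtain p where p: "p \<in> polys d" "v = coset p" by (auto simp: carrier_quot)
      obtain c where "p - (\<Sum>i\<in>X. scale (c i) (e i)) \<in> I" using span[OF p(1)] by blast
      then have "v = coset (\<Sum>i\<in>X. scale (c i) (e i))" using p coset_eq_iff by simp
      also have "(\<Sum>i\<in>X. scale (c i) (e i))
          = (\<Sum>i\<in>X. scale ((c \<circ> inv_into X ?f) (?f i)) (e i))"
        by (intro sum.cong) (simp_all add: inv_into_f_f[OF inj])
      also have "coset \<dots> = V.lincomb (c \<circ> inv_into X ?f) (?f ` X)"
        by (rule lincomb[symmetric])
      finally show "v \<in> V.span (?f ` X)"
        using fin sub by (subst V.finite_span) auto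
    qed
  qed
  ultimately have "V.basis (?f ` X)" using sub by (simp add: V.basis_def)
  then have "V.dim = card (?f ` X)" using fin by (intro V.dim_basis) auto
  then show "alg_dim quot = card X" by (simp add: card_image inj)
  show "alg_fin_dim quot" unfolding V.fin_dim_def using gen fin sub by blast
qed

end

subsection \<open>The ideal of cubes\<close>

definition cube_ideal :: "nat \<Rightarrow> 'k::field nc_poly set"
  where "cube_ideal d = gen_ideal (free_alg d) ((\<lambda>x. x * x * x) ` polys d)"

lemma N_alg_3: "(N_alg 3 d :: ('k::field, _) module) = quot_alg (free_alg d) (cube_ideal d)"
proof -
  have "{list_mult (free_alg d) (replicate 3 x) | x. x \<in> carrier (free_alg d :: ('k, _) module)}
      = (\<lambda>x. x * x * x) ` polys d"
    by (auto simp: list_mult_def numeral_3_eq_3)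
  then show ?thesis by (simp add: N_alg_def cube_ideal_def)
qed

lemma alg_ideal_cube_ideal: "alg_ideal (free_alg d) (cube_ideal d :: 'k::field nc_poly set)"
  unfolding cube_ideal_def by (rule alg_ideal_gen_ideal) auto

lemma cube_in_cube_ideal: "(x :: 'k::field nc_poly) \<in> polys d \<Longrightarrow> x * x * x \<in> cube_ideal d"
  unfolding cube_ideal_def by (rule subsetD[OF gen_ideal_superset]) (rule imageI)

lemma CHAR_bit: "CHAR(bit) = 2"
proof -
  have "(of_nat n :: bit) = 0 \<longleftrightarrow> even n" for n by (induction n) auto
  then show ?thesis by (intro CHAR_eqI) auto
qed

lemma double_zero_field: "CHAR('k::field) = 2 \<Longrightarrow> (a :: 'k) + a = 0"
  by (metis add.right_inverse uminus_CHAR_2)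

lemma double_zero_poly: "CHAR('k::field) = 2 \<Longrightarrow> (p :: 'k nc_poly) + p = 0"
  by (rule poly_mapping_eqI) (simp add: lookup_add double_zero_field)

lemma nil_cube_cube_ideal:
  assumes "CHAR('k::field) = 2"
  shows "nil_cube (polys d) (cube_ideal d :: 'k nc_poly set)"
  using ideal_closed[OF alg_ideal_cube_ideal[where 'k = 'k]] cube_in_cube_ideal[where 'k = 'k]
    double_zero_poly[OF assms]
  by unfold_locales auto

lemma in_ideal_if_keys:
  assumes I: "alg_ideal (free_alg d) I" and "\<And>w. w \<in> Poly_Mapping.keys p \<Longrightarrow> mon (letters w) \<in> I"
  shows "p \<in> I"
proof -
  have "(\<Sum>w\<in>Poly_Mapping.keys p. Poly_Mapping.single w (Poly_Mapping.lookup p w)) \<in> I"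
  proof (rule alg_ideal_sum[OF I])
    fix w assume "w \<in> Poly_Mapping.keys p"
    then have "scale (Poly_Mapping.lookup p w) (mon (letters w)) \<in> I"
      by (intro ideal_closed[OF I] assms)
    also have "scale (Poly_Mapping.lookup p w) (mon (letters w)) = Poly_Mapping.single w (Poly_Mapping.lookup p w)"
      by (simp add: scale_simps)
    finally show "Poly_Mapping.single w (Poly_Mapping.lookup p w) \<in> I" .
  qed
  then show ?thesis by (simp add: sum_single_lookup)
qed

text \<open>Words in the support of elements of \<open>polys d\<close> are nonempty, so lengths grow
  with the number of factors. This reduces the vanishing of arbitrary long products to that of long
  words.\<close>

lemma keys_prod_list:
  assumes "set ps \<subseteq> polys d" "w \<in> Poly_Mapping.keys (prod_list ps)"
  shows "length ps \<le> length (letters w)" "set (letters w) \<subseteq> {1..d}"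
proof -
  have "length ps \<le> length (letters w) \<and> set (letters w) \<subseteq> {1..d}"
    using assms
  proof (induction ps arbitrary: w)
    case Nil
    then show ?case by (auto simp: zero_fword_def split: if_splits)
  next
    case (Cons p ps)
    then obtain u v where uv: "u \<in> Poly_Mapping.keys p" "v \<in> Poly_Mapping.keys (prod_list ps)" "w = u + v"
      using keys_mult[of p "prod_list ps"] by auto
    then have "letters u \<in> words d" using Cons.prems by (auto simp: polys_iff)
    moreover from this have "1 \<le> length (letters u)" by (cases "letters u") auto
    ultimately show ?case using Cons.IH[OF _ uv(2)] Cons.prems uv(3)
      by (auto simp: plus_fword_def)
  qed
  then show "length ps \<le> length (letters w)" "set (letters w) \<subseteq> {1..d}" by auto
qed

subsection \<open>Long products\<close>

text \<open>Without these patterns, either one letter occurs three times and every other at most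
  once, or no letter occurs more than twice and at most two letters do so. Both give length at most
  \<open>d + 2\<close>.\<close>

lemma long_word_repetitions:
  assumes w: "set w \<subseteq> {1..d}" "d + 3 \<le> length w"
  shows "(\<exists>x\<in>set w. {#x, x, x, x#} \<subseteq># mset w) \<or> (\<exists>x\<in>set w. \<exists>y\<in>set w. {#x, x, x, y, y#} \<subseteq># mset w)
    \<or> (\<exists>x\<in>set w. \<exists>y\<in>set w. \<exists>z\<in>set w. {#x, x, y, y, z, z#} \<subseteq># mset w)"
proof (rule ccontr)
  let ?c = "\<lambda>x. count (mset w) x"
  assume contr: "\<not> ?thesis"
  have mem: "n < ?c x \<Longrightarrow> x \<in> set w" for n x
    by (metis count_mset_0_iff not_less_zero)
  have c4: "?c x \<le> 3" for x
  proof (rule ccontr)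
    assume "\<not> ?c x \<le> 3"
    then have "{#x, x, x, x#} \<subseteq># mset w" "x \<in> set w"
      using mem[of 3 x] by (auto simp: subseteq_mset_def)
    then show False using contr by blast
  qed
  have c32: "?c y \<le> 1" if "?c x = 3" "x \<noteq> y" for x y
  proof (rule ccontr)
    assume "\<not> ?c y \<le> 1"
    then have "{#x, x, x, y, y#} \<subseteq># mset w" "x \<in> set w" "y \<in> set w"
      using mem[of 2 x] mem[of 1 y] that by (auto simp: subseteq_mset_def)
    then show False using contr by blast
  qed
  have c222: False if "?c x = 2" "?c y = 2" "?c z = 2" "x \<noteq> y" "x \<noteq> z" "y \<noteq> z" for x y z
  proof -
    have "{#x, x, y, y, z, z#} \<subseteq># mset w" "x \<in> set w" "y \<in> set w" "z \<in> set w"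
      using mem[of 1 x] mem[of 1 y] mem[of 1 z] that by (auto simp: subseteq_mset_def)
    then show False using contr by blast
  qed
  have len: "length w = (\<Sum>x\<in>{1..d}. ?c x)"
    using sum_count_set[of w "{1..d}"] w by (simp add: count_mset)
  show False
  proof (cases "\<exists>x. ?c x = 3")
    case True
    then obtain x where x: "?c x = 3" by blast
    have "length w \<le> (\<Sum>y\<in>{1..d}. 1 + (if y = x then 2 else 0))"
      unfolding len using c32[OF x] x by (intro sum_mono) auto
    also have "\<dots> = (\<Sum>y\<in>{1..d}. 1) + (\<Sum>y\<in>{1..d}. if y = x then 2 else 0)"
      by (rule sum.distrib)
    also have "\<dots> \<le> d + 2" by simp
    finally show False using w by simp
  next
    case False
    define T where "T = {x \<in> {1..d}. ?c x = 2}"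
    have "length w \<le> (\<Sum>y\<in>{1..d}. 1 + (if y \<in> T then 1 else 0))"
      unfolding len
    proof (rule sum_mono)
      fix y assume "y \<in> {1..d}"
      then show "?c y \<le> 1 + (if y \<in> T then 1 else 0)"
        using c4[of y] False by (auto simp: T_def le_less numeral_eq_Suc less_Suc_eq)
    qed
    also have "\<dots> = (\<Sum>y\<in>{1..d}. 1) + (\<Sum>y\<in>{1..d}. if y \<in> T then 1 else 0)"
      by (rule sum.distrib)
    also have "\<dots> = d + card ({1..d} \<inter> T)" by (simp add: sum.If_cases)
    also have "{1..d} \<inter> T = T" by (auto simp: T_def)
    finally have "3 \<le> card T" using w by simp
    then obtain S where "S \<subseteq> T" "card S = 3" by (meson obtain_subset_with_card_n)
    then obtain x y z where "x \<in> T" "y \<in> T" "z \<in> T" "x \<noteq> y" "x \<noteq> z" "y \<noteq> z"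
      by (auto simp: card_3_iff)
    then show False using c222[of x y z] by (simp add: T_def)
  qed
qed

lemma mon_eq_prod_list: "mon w = prod_list (map (\<lambda>i. mon [i]) w)"
proof (induction w)
  case Nil
  then show ?case using single_one[where 'a = "nat fword"] by (simp add: zero_fword_def)
next
  case (Cons i w)
  then show ?case by (simp flip: Cons.IH add: mon_mult)
qed

lemma long_word_in_cube_ideal:
  assumes char: "CHAR('k::field) = 2" and w: "set w \<subseteq> {1..d}" "max 6 (d + 3) \<le> length w"
  shows "mon w \<in> (cube_ideal d :: 'k nc_poly set)"
proof -
  interpret nil_cube "polys d" "cube_ideal d :: 'k nc_poly set"
    by (rule nil_cube_cube_ideal[OF char])
  let ?m = "\<lambda>i. mon [i] :: 'k nc_poly"
  have m: "?m i \<in> polys d" if "i \<in> set w" for i using that w by (intro polys_closed) auto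
  have *: "mon w \<in> (cube_ideal d :: 'k nc_poly set)"
    if "annihilates 6 (image_mset ?m K)" "K \<subseteq># mset w" for K
  proof -
    have "image_mset ?m K \<subseteq># mset (map ?m w)" using that(2) by (simp add: image_mset_subseteq_mono)
    moreover have "set (map ?m w) \<subseteq> polys d" using m by auto
    ultimately show ?thesis
      using that(1) w(2) unfolding annihilates_def mon_eq_prod_list[of w] by simp
  qed
  consider x where "x \<in> set w" "{#x, x, x, x#} \<subseteq># mset w"
    | x y where "x \<in> set w" "y \<in> set w" "{#x, x, x, y, y#} \<subseteq># mset w"
    | x y z where "x \<in> set w" "y \<in> set w" "z \<in> set w" "{#x, x, y, y, z, z#} \<subseteq># mset w"
    using long_word_repetitions[OF w(1)] w(2) by auto
  then show ?thesis
  proof cases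
    case 1
    then show ?thesis using *[of "{#x, x, x, x#}"] annihilates_4[OF m, of x] by simp
  next
    case 2
    then show ?thesis using *[of "{#x, x, x, y, y#}"] annihilates_3_2[OF m m, of x y] by simp
  next
    case 3
    then show ?thesis using *[of "{#x, x, y, y, z, z#}"] annihilates_2_2_2[OF m m m, of x y z] by simp
  qed
qed

lemma long_product_in_cube_ideal:
  assumes "CHAR('k::field) = 2" "set ps \<subseteq> polys d" "max 6 (d + 3) \<le> length ps"
  shows "prod_list ps \<in> (cube_ideal d :: 'k nc_poly set)"
proof (rule in_ideal_if_keys[OF alg_ideal_cube_ideal])
  fix w assume "w \<in> Poly_Mapping.keys (prod_list ps)"
  from keys_prod_list[OF assms(2) this] assms(3)
  show "mon (letters w) \<in> (cube_ideal d :: 'k nc_poly set)"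
    by (intro long_word_in_cube_ideal[OF assms(1)]) auto
qed

subsection \<open>The ideal of linearized relations on words\<close>

text \<open>Generators of the ideal J of the overview. They have integer coefficients and involve
  words only, so the same formulas define J over every field.\<close>

definition word_rels :: "nat \<Rightarrow> 'k::field nc_poly set"
  where "word_rels d = {mon a * mon a * mon a | a. a \<in> words d}
    \<union> {lin2 (mon a) (mon b) | a b. a \<in> words d \<and> b \<in> words d}
    \<union> {lin3 (mon a) (mon b) (mon c) | a b c. a \<in> words d \<and> b \<in> words d \<and> c \<in> words d}"

definition word_ideal :: "nat \<Rightarrow> 'k::field nc_poly set"
  where "word_ideal d = gen_ideal (free_alg d) (word_rels d)"

lemma word_relsI:
  assumes "a \<in> words d" "b \<in> words d" "c \<in> words d"
  shows "mon a * mon a * mon a \<in> word_rels d" "lin2 (mon a) (mon b) \<in> word_rels d"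
    "lin3 (mon a) (mon b) (mon c) \<in> word_rels d"
  unfolding word_rels_def using assms by blast+

lemma lin_closed:
  "p \<in> polys d \<Longrightarrow> q \<in> polys d \<Longrightarrow> lin2 p q \<in> polys d"
  "p \<in> polys d \<Longrightarrow> q \<in> polys d \<Longrightarrow> r \<in> polys d \<Longrightarrow> lin3 p q r \<in> polys d"
  unfolding lin2_def lin3_def by (simp_all only: polys_closed)

lemma word_rels_subset: "word_rels d \<subseteq> polys d"
  unfolding word_rels_def
  by safe (intro polys_closed lin_closed CollectI conjI; assumption)+

lemma alg_ideal_word_ideal: "alg_ideal (free_alg d) (word_ideal d :: 'k::field nc_poly set)"
  unfolding word_ideal_def by (rule alg_ideal_gen_ideal[OF word_rels_subset])

lemma word_rels_in: "word_rels d \<subseteq> word_ideal d"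
  unfolding word_ideal_def by (rule gen_ideal_superset)

text \<open>\<open>lin2\<close> is quadratic in its first argument with polar form
  \<open>lin3\<close>. Therefore \<open>lin3\<close> has to be extended from words to polynomials
  before \<open>lin2\<close>.\<close>

lemma lin_add:
  "lin2 p (q + q') = lin2 p q + lin2 p q'"
  "lin2 (p + p') q = lin2 p q + lin2 p' q + lin3 p p' q"
  "lin3 (p + p') q r = lin3 p q r + lin3 p' q r"
  "lin3 p (q + q') r = lin3 p q r + lin3 p q' r"
  "lin3 p q (r + r') = lin3 p q r + lin3 p q r'"
  by (simp_all add: lin2_def lin3_def algebra_simps)

lemma lin_scale:
  "lin2 (scale c p) q = scale (c * c) (lin2 p q)" "lin2 p (scale c q) = scale c (lin2 p q)"
  "lin3 (scale c p) q r = scale c (lin3 p q r)" "lin3 p (scale c q) r = scale c (lin3 p q r)"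
  "lin3 p q (scale c r) = scale c (lin3 p q r)"
  by (simp_all add: lin2_def lin3_def scale_simps flip: scale_mult_left scale_mult_right)

lemma lin_zero: "lin2 0 q = 0" "lin2 p 0 = 0" "lin3 0 q r = 0" "lin3 p 0 r = 0" "lin3 p q 0 = 0"
  by (simp_all add: lin2_def lin3_def)

lemma single_eq_scale: "Poly_Mapping.single (Word w) c = scale c (mon w)"
  by (simp add: scale_simps)

lemma lin3_in_word_ideal:
  fixes p q r :: "'k::field nc_poly"
  assumes pqr: "p \<in> polys d" "q \<in> polys d" "r \<in> polys d"
  shows "lin3 p q r \<in> word_ideal d"
proof -
  note I = ideal_closed[OF alg_ideal_word_ideal[of d, where 'k = 'k]]
  have 1: "lin3 (mon a) (mon b) r \<in> word_ideal d" if "a \<in> words d" "b \<in> words d" "r \<in> polys d"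
    for a b and r :: "'k nc_poly"
    using that(3)
  proof (induction r rule: polys_induct)
    case (single c w)
    then have "lin3 (mon a) (mon b) (mon w) \<in> (word_ideal d :: 'k nc_poly set)"
      using that(1,2) by (intro subsetD[OF word_rels_in] word_relsI)
    then show ?case using I by (simp only: single_eq_scale[of w c] lin_scale)
  qed (use I in \<open>auto simp: lin_zero lin_add\<close>)
  have 2: "lin3 (mon a) q r \<in> word_ideal d" if "a \<in> words d" "q \<in> polys d" "r \<in> polys d"
    for a and q r :: "'k nc_poly"
    using that(2)
  proof (induction q rule: polys_induct)
    case (single c w)
    then have "lin3 (mon a) (mon w) r \<in> word_ideal d" using 1 that by blast
    then show ?case using I by (simp only: single_eq_scale[of w c] lin_scale)
  qed (use I in \<open>auto simp: lin_zero lin_add\<close>)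
  show ?thesis using pqr(1)
  proof (induction p rule: polys_induct)
    case (single c w)
    then have "lin3 (mon w) q r \<in> word_ideal d" using 2 pqr by blast
    then show ?case using I by (simp only: single_eq_scale[of w c] lin_scale)
  qed (use I in \<open>auto simp: lin_zero lin_add\<close>)
qed

lemma lin2_in_word_ideal:
  fixes p q :: "'k::field nc_poly"
  assumes "p \<in> polys d" "q \<in> polys d"
  shows "lin2 p q \<in> word_ideal d"
proof -
  note I = ideal_closed[OF alg_ideal_word_ideal[of d, where 'k = 'k]]
  have *: "lin2 (mon a) q \<in> word_ideal d" if "a \<in> words d" for a
    using assms(2)
  proof (induction q rule: polys_induct)
    case (single c w)
    then have "lin2 (mon a) (mon w) \<in> (word_ideal d :: 'k nc_poly set)"
      using that by (intro subsetD[OF word_rels_in] word_relsI)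
    then show ?case using I by (simp only: single_eq_scale[of w c] lin_scale)
  qed (use I in \<open>auto simp: lin_zero lin_add\<close>)
  show ?thesis
    using assms(1)
  proof (induction p rule: polys_induct)
    case (single c w)
    then show ?case using I * by (simp only: single_eq_scale[of w c] lin_scale)
  next
    case (add p p')
    then show ?case unfolding lin_add using assms(2) by (intro I(3) lin3_in_word_ideal)
  qed (simp add: lin_zero I(2))
qed

lemma cube_in_word_ideal:
  fixes p :: "'k::field nc_poly"
  assumes "p \<in> polys d"
  shows "p * p * p \<in> word_ideal d"
  using assms
proof (induction p rule: polys_induct)
  case zero
  then show ?case using ideal_closed(2)[OF alg_ideal_word_ideal[of d]] by simp
next
  case (single c w)
  then have "mon w * mon w * mon w \<in> (word_ideal d :: 'k nc_poly set)"
    by (intro subsetD[OF word_rels_in] word_relsI)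
  then have "scale (c * c * c) (mon w * mon w * mon w) \<in> (word_ideal d :: 'k nc_poly set)"
    by (rule ideal_closed(4)[OF alg_ideal_word_ideal])
  moreover have "Poly_Mapping.single (Word w) c * Poly_Mapping.single (Word w) c * Poly_Mapping.single (Word w) c
      = scale (c * c * c) (mon w * mon w * mon w)"
    by (simp add: mult_single scale_simps)
  ultimately show ?case by simp
next
  case (add p q)
  have "(p + q) * (p + q) * (p + q) = p * p * p + q * q * q + lin2 p q + lin2 q p"
    by (simp add: lin2_def algebra_simps)
  then show ?case
    using add lin2_in_word_ideal[of p d q] lin2_in_word_ideal[of q d p]
    by (simp add: ideal_closed(3)[OF alg_ideal_word_ideal])
qed

lemma cube_ideal_subset: "cube_ideal d \<subseteq> word_ideal d"
  unfolding cube_ideal_def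
  by (rule gen_ideal_least[OF alg_ideal_word_ideal]) (auto intro: cube_in_word_ideal)

lemma word_ideal_subset:
  assumes char: "CHAR('k::field) = 2" and inf: "infinite (UNIV :: 'k set)"
  shows "word_ideal d \<subseteq> (cube_ideal d :: 'k nc_poly set)"
proof -
  interpret nil_cube "polys d" "cube_ideal d :: 'k nc_poly set"
    by (rule nil_cube_cube_ideal[OF char])
  note I = ideal_closed[OF alg_ideal_cube_ideal[of d, where 'k = 'k]]
  have mon: "mon a \<in> (polys d :: 'k nc_poly set)" if "a \<in> words d" for a
    using that by (rule polys_closed)
  have "\<not> (UNIV :: 'k set) \<subseteq> {0, 1}" using inf finite_subset by blast
  then obtain c :: 'k where c: "c \<noteq> 0" "c \<noteq> 1" by blast
  have lin2: "lin2 p q \<in> cube_ideal d" if pq: "p \<in> polys d" "q \<in> polys d" for p q :: "'k nc_poly"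
  proof -
    \<comment> \<open>Scaling \<open>q\<close> weights the two halves by c and c^2. Once the second
      is cancelled, \<open>lin2 p q\<close> has the coefficient c + c^2, which is nonzero for c
      outside {0, 1}.\<close>
    have "lin2 p (scale c q) + lin2 (scale c q) p \<in> cube_ideal d"
      using pq by (intro lin2_swap_in polys_closed)
    then have "scale c (lin2 p q) + scale (c * c) (lin2 q p) \<in> cube_ideal d"
      by (simp only: lin_scale)
    moreover have "scale (c * c) (lin2 p q + lin2 q p) \<in> cube_ideal d"
      using lin2_swap_in[OF pq] I by blast
    ultimately have "scale c (lin2 p q) + scale (c * c) (lin2 q p) + scale (c * c) (lin2 p q + lin2 q p) \<in> cube_ideal d"
      by (rule I_add)
    also have "scale c (lin2 p q) + scale (c * c) (lin2 q p) + scale (c * c) (lin2 p q + lin2 q p)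
        = scale (c + c * c) (lin2 p q)"
      by (simp add: scale_simps add_ac)
    finally have "scale (inverse (c + c * c)) (scale (c + c * c) (lin2 p q)) \<in> cube_ideal d"
      using I by blast
    moreover have "inverse (c + c * c) * (c + c * c) = 1"
    proof (rule left_inverse, rule notI)
      assume "c + c * c = 0"
      then have "c * (1 + c) = 0" by (simp add: algebra_simps)
      then have "1 + c = 0" using c by simp
      then show False using c double_zero_field[OF char, of 1] by (metis add_left_cancel)
    qed
    ultimately show ?thesis by (simp only: scale_simps(3,4))
  qed
  have "word_rels d \<subseteq> (cube_ideal d :: 'k nc_poly set)"
    unfolding word_rels_def
    by safe (intro cube_in lin2 lin3_in mon CollectI conjI; assumption)+
  then show ?thesis unfolding word_ideal_def by (rule gen_ideal_least[OF alg_ideal_cube_ideal])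
qed

subsection \<open>Functionals on words\<close>

text \<open>
  Functionals take their values in the two-element field, so that the same family of functionals
  serves all fields of characteristic 2.
\<close>

definition emb :: "bit \<Rightarrow> 'k::field"
  where "emb b = (if b = 0 then 0 else 1)"

lemma emb_simps [simp]: "emb 0 = 0" "emb 1 = 1" "emb (a * b) = emb a * emb b"
  by (auto simp: emb_def)

lemma emb_add: "CHAR('k::field) = 2 \<Longrightarrow> (emb (a + b) :: 'k) = emb a + emb b"
  using double_zero_field[of "1 :: 'k"] by (cases a; cases b) auto

lemma emb_diff: "CHAR('k::field) = 2 \<Longrightarrow> (emb (a - b) :: 'k) = emb a - emb b"
  using uminus_CHAR_2[of "1 :: 'k"] by (cases a; cases b) (auto simp: emb_def)

lemma double_zero_bit: "(b::bit) + b = 0" "(b::bit) + (b + c) = c"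
  by (cases b; cases c; simp)+

text \<open>This is what the linear extension of \<open>f\<close> must satisfy in order to vanish on
  J. The value type is general because the coordinate functionals first arise with values in a
  field.\<close>

definition compatible :: "nat \<Rightarrow> (nat list \<Rightarrow> 'a::comm_monoid_add) \<Rightarrow> bool"
  where "compatible d f \<longleftrightarrow> (\<forall>u v. \<forall>a\<in>words d. \<forall>b\<in>words d. \<forall>c\<in>words d.
    set u \<subseteq> {1..d} \<longrightarrow> set v \<subseteq> {1..d} \<longrightarrow>
      f (u @ a @ a @ a @ v) = 0
      \<and> f (u @ a @ a @ b @ v) + f (u @ a @ b @ a @ v) + f (u @ b @ a @ a @ v) = 0
      \<and> f (u @ a @ b @ c @ v) + f (u @ a @ c @ b @ v) + f (u @ b @ a @ c @ v)
        + f (u @ b @ c @ a @ v) + f (u @ c @ a @ b @ v) + f (u @ c @ b @ a @ v) = 0)"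

definition functional :: "(nat list \<Rightarrow> bit) \<Rightarrow> 'k::field nc_poly \<Rightarrow> 'k"
  where "functional f p = (\<Sum>w\<in>Poly_Mapping.keys p. Poly_Mapping.lookup p w * emb (f (letters w)))"

lemma functional_superset:
  assumes "finite A" "Poly_Mapping.keys p \<subseteq> A"
  shows "functional f p = (\<Sum>w\<in>A. Poly_Mapping.lookup p w * emb (f (letters w)))"
  unfolding functional_def using assms by (intro sum.mono_neutral_left) (auto simp: in_keys_iff)

lemma functional_add: "functional f (p + q) = functional f p + functional f q"
proof -
  let ?A = "Poly_Mapping.keys p \<union> Poly_Mapping.keys q"
  have "finite ?A" by simp
  from functional_superset[OF this, of "p + q"] functional_superset[OF this, of p]
    functional_superset[OF this, of q] keys_add[of p q]
  show ?thesis by (simp add: lookup_add distrib_right sum.distrib)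
qed

lemma functional_scale: "functional f (scale c p) = c * functional f p"
proof -
  have "Poly_Mapping.keys (scale c p) \<subseteq> Poly_Mapping.keys p"
    by (auto simp: in_keys_iff lookup_smult)
  from functional_superset[OF finite_keys this, of f] show ?thesis
    by (simp add: functional_def lookup_smult sum_distrib_left mult.assoc)
qed

lemma functional_zero: "functional f 0 = 0"
  by (simp add: functional_def)

lemma functional_mon: "functional f (mon w) = emb (f w)"
  by (simp add: functional_def)

lemma functional_sum: "functional f (sum g A) = (\<Sum>i\<in>A. functional f (g i))"
  by (induction A rule: infinite_finite_induct) (auto simp: functional_zero functional_add)

lemma functional_word_ideal:
  assumes char: "CHAR('k::field) = 2" and resp: "compatible d f" and p: "p \<in> (word_ideal d :: 'k nc_poly set)"
  shows "functional f p = 0"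
proof -
  let ?L = "{u. set u \<subseteq> {1..d}}"
  \<comment> \<open>The kernel of \<open>functional f\<close> need not be an ideal; the elements
    killed in all contexts form one.\<close>
  define K where "K = {p \<in> (polys d :: 'k nc_poly set). \<forall>u\<in>?L. \<forall>v\<in>?L. functional f (mon u * p * mon v) = 0}"
  have mult: "a * p \<in> K \<and> p * a \<in> K" if p: "p \<in> K" and a: "a \<in> polys d" for a p :: "'k nc_poly"
    using a
  proof (induction a rule: polys_induct)
    case zero
    then show ?case by (simp add: K_def functional_zero)
  next
    case (single c w)
    have "functional f (mon u * (Poly_Mapping.single (Word w) c * p) * mon v) = 0
      \<and> functional f (mon u * (p * Poly_Mapping.single (Word w) c) * mon v) = 0"
      if uv: "u \<in> ?L" "v \<in> ?L" for u v
    proof -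
      have "mon u * (Poly_Mapping.single (Word w) c * p) * mon v = scale c (mon (u @ w) * p * mon v)"
        unfolding single_eq_scale[of w c]
        by (simp only: mon_mult[symmetric] scale_mult_left[symmetric] scale_mult_right[symmetric] mult.assoc)
      moreover have "mon u * (p * Poly_Mapping.single (Word w) c) * mon v = scale c (mon u * p * mon (w @ v))"
        unfolding single_eq_scale[of w c]
        by (simp only: mon_mult[symmetric] scale_mult_left[symmetric] scale_mult_right[symmetric] mult.assoc)
      moreover have "u @ w \<in> ?L" "w @ v \<in> ?L" using uv single by auto
      ultimately show ?thesis using p uv by (simp add: K_def functional_scale)
    qed
    moreover have "p \<in> polys d" "Poly_Mapping.single (Word w) c \<in> polys d"
      using p single by (auto simp: K_def)
    ultimately show ?case by (simp add: K_def)
  next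
    case (add a b)
    then show ?case by (simp add: K_def distrib_left distrib_right functional_add)
  qed
  have "alg_ideal (free_alg d) K"
    unfolding alg_ideal_iff
  proof (intro conjI ballI allI)
    show "K \<subseteq> polys d" "0 \<in> K" by (auto simp: K_def functional_zero)
    fix x y assume "x \<in> K" "y \<in> K"
    then show "x + y \<in> K" by (simp add: K_def distrib_left distrib_right functional_add)
  next
    fix c x assume "x \<in> K"
    then show "scale c x \<in> K"
      by (simp add: K_def functional_scale flip: scale_mult_left scale_mult_right)
  qed (use mult in auto)
  moreover have "word_rels d \<subseteq> K"
  proof
    fix p :: "'k nc_poly" assume p: "p \<in> word_rels d"
    have "functional f (mon u * p * mon v) = 0" if uv: "u \<in> ?L" "v \<in> ?L" for u v
    proof -
      consider a where "a \<in> words d" "p = mon a * mon a * mon a"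
        | a b where "a \<in> words d" "b \<in> words d" "p = lin2 (mon a) (mon b)"
        | a b c where "a \<in> words d" "b \<in> words d" "c \<in> words d" "p = lin3 (mon a) (mon b) (mon c)"
        using p unfolding word_rels_def by blast
      then show ?thesis
      proof cases
        case 1
        then have "f (u @ a @ a @ a @ v) = 0" using resp uv unfolding compatible_def by blast
        then show ?thesis by (simp add: 1(2) mon_mult functional_mon)
      next
        case 2
        then have "f (u @ a @ a @ b @ v) + f (u @ a @ b @ a @ v) + f (u @ b @ a @ a @ v) = 0"
          using resp uv unfolding compatible_def by blast
        then have "emb (f (u @ a @ a @ b @ v) + f (u @ a @ b @ a @ v) + f (u @ b @ a @ a @ v)) = (0 :: 'k)"
          by (simp only: emb_simps)
        then show ?thesis unfolding emb_add[OF char]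
          by (simp add: 2(3) lin2_def distrib_left distrib_right functional_add mon_mult functional_mon)
      next
        case 3
        then have "f (u @ a @ b @ c @ v) + f (u @ a @ c @ b @ v) + f (u @ b @ a @ c @ v)
          + f (u @ b @ c @ a @ v) + f (u @ c @ a @ b @ v) + f (u @ c @ b @ a @ v) = 0"
          using resp uv unfolding compatible_def by blast
        then have "emb (f (u @ a @ b @ c @ v) + f (u @ a @ c @ b @ v) + f (u @ b @ a @ c @ v)
          + f (u @ b @ c @ a @ v) + f (u @ c @ a @ b @ v) + f (u @ c @ b @ a @ v)) = (0 :: 'k)"
          by (simp only: emb_simps)
        then show ?thesis unfolding emb_add[OF char]
          by (simp add: 3(4) lin3_def distrib_left distrib_right functional_add mon_mult functional_mon)
      qed
    qed
    then show "p \<in> K" using p word_rels_subset[of d] by (auto simp: K_def)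
  qed
  ultimately have "word_ideal d \<subseteq> K" unfolding word_ideal_def by (rule gen_ideal_least)
  then have "functional f (mon [] * p * mon []) = 0" using p by (auto simp: K_def)
  moreover have "mon [] = (1 :: 'k nc_poly)" by (simp add: single_one flip: zero_fword_def)
  ultimately show ?thesis by simp
qed

subsection \<open>A nonzero product\<close>

text \<open>
  The parity of the number of factors \<open>11\<close> vanishes on the relations in the multidegree
  \<open>(3, 1, \<dots>, 1)\<close>, respectively \<open>(3, 2)\<close> for two letters.
\<close>

definition first1 :: "nat list \<Rightarrow> bit"
  where "first1 w = (if w \<noteq> [] \<and> hd w = 1 then 1 else 0)"

definition last1 :: "nat list \<Rightarrow> bit"
  where "last1 w = (if w \<noteq> [] \<and> last w = 1 then 1 else 0)"

fun factors11 :: "nat list \<Rightarrow> bit"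
  where "factors11 (x # y # w) = (if x = 1 \<and> y = 1 then 1 else 0) + factors11 (y # w)"
  | "factors11 _ = 0"

text \<open>The defect of additivity depends only on the two letters at the joint. In the relations
  the joints that occur an even number of times cancel.\<close>

lemma factors11_append: "factors11 (u @ v) = factors11 u + factors11 v + last1 u * first1 v"
proof (induction u rule: factors11.induct)
  case ("2_2" x)
  then show ?case by (cases v) (auto simp: last1_def first1_def)
qed (auto simp: last1_def first1_def add_ac)

lemma first1_append: "u \<noteq> [] \<Longrightarrow> first1 (u @ v) = first1 u"
  by (simp add: first1_def)

lemma factors11_eq_0: "count (mset w) 1 \<le> 1 \<Longrightarrow> factors11 w = 0"
  by (induction w rule: factors11.induct) (auto split: if_splits)

lemmas factors11_simps = factors11_append first1_append distrib_left distrib_right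
  add_ac double_zero_bit add_0_left add_0_right simp_thms

lemma factors11_cube: "a \<noteq> [] \<Longrightarrow> factors11 (u @ a @ a @ a @ v) = factors11 (u @ a @ v)"
  by (simp only: factors11_simps)

lemma factors11_lin2:
  "a \<noteq> [] \<Longrightarrow> b \<noteq> [] \<Longrightarrow>
    factors11 (u @ a @ a @ b @ v) + factors11 (u @ a @ b @ a @ v) + factors11 (u @ b @ a @ a @ v)
      = factors11 (u @ b @ v)"
  by (simp only: factors11_simps)

lemma factors11_lin3:
  "a \<noteq> [] \<Longrightarrow> b \<noteq> [] \<Longrightarrow> c \<noteq> [] \<Longrightarrow>
    factors11 (u @ a @ b @ c @ v) + factors11 (u @ a @ c @ b @ v) + factors11 (u @ b @ a @ c @ v)
      + factors11 (u @ b @ c @ a @ v) + factors11 (u @ c @ a @ b @ v) + factors11 (u @ c @ b @ a @ v) = 0"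
  by (simp only: factors11_simps)

definition multidegree :: "nat \<Rightarrow> nat multiset"
  where "multidegree d = {#1, 1, 1#} + (if d = 2 then {#2, 2#} else mset_set {2..d})"

lemma count_multidegree:
  "count (multidegree d) 1 = 3" "i \<noteq> 1 \<Longrightarrow> count (multidegree d) i \<le> 2"
  "i \<noteq> 1 \<Longrightarrow> 2 \<le> count (multidegree d) i \<Longrightarrow> d = 2 \<and> i = 2"
  by (auto simp: multidegree_def count_mset_set' split: if_splits)

lemma compatible_factors11: "compatible d (\<lambda>w. if mset w = multidegree d then factors11 w else 0)"
  unfolding compatible_def
proof (intro allI ballI impI conjI)
  fix u v a b c assume abc: "a \<in> words d" "b \<in> words d" "c \<in> words d"
  let ?f = "\<lambda>w. if mset w = multidegree d then factors11 w else 0"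
  show "?f (u @ a @ a @ a @ v) = 0"
  proof (cases "mset (u @ a @ a @ a @ v) = multidegree d")
    case True
    then have cnt: "count (multidegree d) i = count (mset (u @ v)) i + 3 * count (mset a) i" for i
      by (simp flip: True)
    \<comment> \<open>Each letter of \<open>a\<close> occurs at least three times in the whole word,
      so \<open>a\<close> is the single letter 1, and only one 1 is left after the reduction by
      \<open>factors11_cube\<close>.\<close>
    have "count (mset a) i = 0" if "i \<noteq> 1" for i
      using cnt[of i] count_multidegree(2)[OF that, of d] by linarith
    then have "set a \<subseteq> {1}" by (metis count_mset_0_iff insertI1 subsetI)
    then have "1 \<in> set a" using abc by (cases a) auto
    then have "count (mset a) 1 \<noteq> 0" by (simp only: count_mset_0_iff not_not)
    then have "count (mset (u @ a @ v)) 1 \<le> 1"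
      using cnt[of 1] count_multidegree(1)[of d] unfolding mset_append count_union by linarith
    then show ?thesis using abc by (simp add: factors11_cube factors11_eq_0)
  qed simp
  have "factors11 (u @ b @ v) = 0" if eq: "mset (u @ a @ a @ b @ v) = multidegree d"
  proof -
    have cnt: "count (multidegree d) i = count (mset (u @ b @ v)) i + 2 * count (mset a) i" for i
      by (simp flip: eq)
    show ?thesis
    proof (cases "1 \<in> set a")
      case True
      then have "count (mset a) 1 \<noteq> 0" by (simp only: count_mset_0_iff not_not)
      then show ?thesis
        using cnt[of 1] count_multidegree(1)[of d] by (intro factors11_eq_0) linarith
    next
      \<comment> \<open>A letter other than 1 that occurs twice forces d = 2. Then 111 is left for
        \<open>u @ b @ v\<close>, and its two factors 11 cancel.\<close>
      case False
      then have "count (mset a) 1 = 0" by (rule iffD2[OF count_mset_0_iff])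
      obtain i where "i \<in> set a" using abc by (cases a) auto
      then have "count (mset a) i \<noteq> 0" by (simp only: count_mset_0_iff not_not)
      moreover have "i \<noteq> 1" using False \<open>i \<in> set a\<close> by blast
      ultimately have i: "d = 2" "i = 2"
        using cnt[of i] count_multidegree(3)[of i d] by linarith+
      have "mset (u @ b @ v) = {#1, 1, 1#}"
      proof (rule multiset_eqI)
        fix j
        have "count (multidegree d) j = (if j = 1 then 3 else if j = 2 then 2 else 0)"
          using i by (simp add: multidegree_def)
        define x y where "x = count (mset (u @ b @ v)) j" and "y = count (mset a) j"
        have "x + 2 * y = (if j = 1 then 3 else if j = 2 then 2 else 0)"
          unfolding x_def y_def cnt[of j, symmetric] by fact
        moreover have "j = 1 \<Longrightarrow> y = 0" "j = 2 \<Longrightarrow> y \<noteq> 0"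
          using \<open>count (mset a) i \<noteq> 0\<close> \<open>count (mset a) 1 = 0\<close> i unfolding y_def by blast+
        ultimately have "x = (if j = 1 then 3 else 0)" by (auto split: if_splits)
        then show "count (mset (u @ b @ v)) j = count {#1, 1, 1#} j" by (simp add: x_def)
      qed
      then have "length (u @ b @ v) = 3" "set (u @ b @ v) = {1}"
        by (metis size_mset size_add_mset size_empty numeral_3_eq_3) (metis set_mset_mset set_mset_add_mset_insert set_mset_empty insert_absorb2 \<open>mset (u @ b @ v) = {#1, 1, 1#}\<close>)
      then have "u @ b @ v = replicate 3 1"
        by (metis replicate_eqI singletonD)
      then show ?thesis by (simp add: numeral_3_eq_3 double_zero_bit)
    qed
  qed
  moreover have eqs: "mset (u @ a @ b @ a @ v) = mset (u @ a @ a @ b @ v)"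
    "mset (u @ b @ a @ a @ v) = mset (u @ a @ a @ b @ v)"
    by (simp_all add: ac_simps)
  ultimately show "?f (u @ a @ a @ b @ v) + ?f (u @ a @ b @ a @ v) + ?f (u @ b @ a @ a @ v) = 0"
    using factors11_lin2[of a b u v] abc
    by (cases "mset (u @ a @ a @ b @ v) = multidegree d") (simp_all only: eqs if_True if_False mem_Collect_eq simp_thms add_0_left)
  have eqs: "mset (u @ a @ c @ b @ v) = mset (u @ a @ b @ c @ v)"
    "mset (u @ b @ a @ c @ v) = mset (u @ a @ b @ c @ v)"
    "mset (u @ b @ c @ a @ v) = mset (u @ a @ b @ c @ v)"
    "mset (u @ c @ a @ b @ v) = mset (u @ a @ b @ c @ v)"
    "mset (u @ c @ b @ a @ v) = mset (u @ a @ b @ c @ v)"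
    by (simp_all add: ac_simps)
  show "?f (u @ a @ b @ c @ v) + ?f (u @ a @ c @ b @ v) + ?f (u @ b @ a @ c @ v)
    + ?f (u @ b @ c @ a @ v) + ?f (u @ c @ a @ b @ v) + ?f (u @ c @ b @ a @ v) = 0"
    using factors11_lin3[of a b c u v] abc
    by (cases "mset (u @ a @ b @ c @ v) = multidegree d") (simp_all only: eqs if_True if_False mem_Collect_eq simp_thms add_0_left)
qed

text \<open>The third 1 is kept apart from the first two, so that there is exactly one factor 11;
  the tail only completes the multidegree.\<close>

definition witness :: "nat \<Rightarrow> nat list"
  where "witness d = [1, 1, 2, 1] @ (if d = 2 then [2] else [3..<Suc d])"

lemma witness:
  assumes "2 \<le> d"
  shows "set (witness d) \<subseteq> {1..d}" "Suc (length (witness d)) = max 6 (d + 3)"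
    "mset (witness d) = multidegree d" "factors11 (witness d) = 1"
proof -
  show "set (witness d) \<subseteq> {1..d}" "Suc (length (witness d)) = max 6 (d + 3)"
    using assms by (auto simp: witness_def)
  have "{2..d} = insert 2 {3..<Suc d}" using assms by auto
  then show "mset (witness d) = multidegree d"
    by (auto simp: witness_def multidegree_def mset_upt simp del: upt_Suc)
  have "factors11 (1 # (if d = 2 then [2] else [3..<Suc d])) = 0"
    by (rule factors11_eq_0) (auto simp: count_mset_set')
  then show "factors11 (witness d) = 1"
    by (simp add: witness_def split: if_splits)
qed

lemma witness_notin_cube_ideal:
  assumes char: "CHAR('k::field) = 2" and d: "2 \<le> d"
  shows "mon (witness d) \<notin> (cube_ideal d :: 'k nc_poly set)"
proof
  let ?f = "\<lambda>w. if mset w = multidegree d then factors11 w else 0"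
  assume "mon (witness d) \<in> (cube_ideal d :: 'k nc_poly set)"
  then have "functional ?f (mon (witness d) :: 'k nc_poly) = 0"
    using functional_word_ideal[OF char compatible_factors11] cube_ideal_subset by blast
  then show False using witness[OF d] by (simp add: functional_mon)
qed

lemma C_deg_3:
  assumes char: "CHAR('k::field) = 2" and d: "2 \<le> d"
  shows "C_deg 3 d TYPE('k) = max 6 (d + 3)"
  unfolding C_deg_def N_alg_3
proof (rule nilpotency_degree_quot[OF alg_ideal_cube_ideal])
  let ?ps = "map (\<lambda>i. mon [i]) (witness d) :: 'k nc_poly list"
  show "prod_list ps \<in> cube_ideal d" if "length ps = max 6 (d + 3)" "set ps \<subseteq> polys d"
    for ps :: "'k nc_poly list"
    using long_product_in_cube_ideal[OF char that(2)] that(1) by simp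
  show "Suc (length ?ps) = max 6 (d + 3)" using witness[OF d] by simp
  show "set ?ps \<subseteq> polys d"
  proof safe
    fix p assume "p \<in> set ?ps"
    then obtain i where "i \<in> set (witness d)" "p = mon [i]" by auto
    moreover from this have "[i] \<in> words d" using witness(1)[OF d] by auto
    ultimately show "p \<in> polys d" by (auto simp del: One_nat_def intro: polys_closed(5))
  qed
  show "prod_list ?ps \<notin> cube_ideal d"
    using witness_notin_cube_ideal[OF char d] by (simp only: mon_eq_prod_list[of "witness d"] not_False_eq_True)
qed simp

subsection \<open>A basis of words, independent of the field\<close>

lemma vector_space_scale: "vector_space (scale :: 'k::field \<Rightarrow> 'k nc_poly \<Rightarrow> _)"
  by unfold_locales (simp_all add: scale_simps)

lemma mon_eq_iff: "mon u = (mon v :: 'k::field nc_poly) \<longleftrightarrow> u = v"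
proof
  assume eq: "mon u = (mon v :: 'k nc_poly)"
  have "Poly_Mapping.keys (mon u :: 'k nc_poly) = {Word u}" "Poly_Mapping.keys (mon v :: 'k nc_poly) = {Word v}"
    by simp_all
  then show "u = v" unfolding eq by simp
qed simp

text \<open>A basis \<open>S\<close> of J is extended by words to a basis \<open>T\<close>. The
  added words form \<open>W\<close>, and \<open>f b\<close> is the coordinate at \<open>b\<close>.
  Coordinates outside \<open>S\<close> vanish on J, which makes these functionals
  compatible.\<close>

lemma word_basis_coordinates:
  assumes char: "CHAR('k::field) = 2"
  obtains W :: "nat list set" and f :: "nat list \<Rightarrow> nat list \<Rightarrow> 'k::field"
  where "finite W" "W \<subseteq> words d" "\<And>b. b \<in> W \<Longrightarrow> compatible d (f b)"
    "\<And>b b'. b \<in> W \<Longrightarrow> b' \<in> W \<Longrightarrow> f b b' = (if b' = b then 1 else 0)"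
    "\<And>w. w \<in> words d \<Longrightarrow> mon w - (\<Sum>b\<in>W. scale (f b w) (mon b)) \<in> (word_ideal d :: 'k nc_poly set)"
proof -
  let ?J = "word_ideal d :: 'k nc_poly set"
  interpret vs: vector_space "scale :: 'k \<Rightarrow> 'k nc_poly \<Rightarrow> _" by (rule vector_space_scale)
  note J = ideal_closed[OF alg_ideal_word_ideal[of d, where 'k = 'k]]
  have subJ: "vs.subspace ?J"
    by (rule vs.subspaceI) (use J in auto)
  obtain S where S: "S \<subseteq> ?J" "vs.independent S" "?J \<subseteq> vs.span S"
    by (rule vs.maximal_independent_subset)
  have spanS: "vs.span S = ?J"
    using S vs.span_minimal[OF S(1) subJ] by blast
  obtain T where T: "S \<subseteq> T" "T \<subseteq> S \<union> mon ` words d" "vs.independent T" "S \<union> mon ` words d \<subseteq> vs.span T"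
    by (rule vs.maximal_independent_subset_extend[of S "S \<union> mon ` words d"]) (use S in auto)
  define W where "W = {w \<in> words d. mon w \<in> T - S}"
  define f where "f b w = vs.representation T (mon w) (mon b)" for b w
  have WT: "mon b \<in> T" "mon b \<notin> S" if "b \<in> W" for b using that by (auto simp: W_def)
  have span_word: "mon w \<in> vs.span T" if "w \<in> words d" for w using T(4) that by blast
  have rep_J: "vs.representation T p v = 0" if "p \<in> ?J" "v \<notin> S" for p v
  proof -
    have "vs.representation T p = vs.representation S p"
      using that(1) spanS T by (intro vs.representation_extend) auto
    then show ?thesis using vs.representation_ne_zero[of S p v] that(2) by metis
  qed
  \<comment> \<open>Long words lie in J, hence in the span of \<open>S\<close>, and are never added;
    this makes \<open>W\<close> finite.\<close>
  have long: "length w < max 6 (d + 3)" if w: "w \<in> W" for w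
  proof (rule ccontr)
    assume "\<not> length w < max 6 (d + 3)"
    then have "mon w \<in> (cube_ideal d :: 'k nc_poly set)"
      using w by (intro long_word_in_cube_ideal[OF char]) (auto simp: W_def)
    then have "mon w \<in> vs.span S" using cube_ideal_subset spanS by blast
    moreover have "S \<subseteq> T - {mon w}" using T(1) WT[OF w] by blast
    ultimately have "mon w \<in> vs.span (T - {mon w})" using vs.span_mono by blast
    then show False using T(3) WT[OF w] unfolding vs.dependent_def by blast
  qed
  have fin: "finite W"
  proof (rule finite_subset)
    show "W \<subseteq> {w. set w \<subseteq> {1..d} \<and> length w \<le> max 6 (d + 3)}"
      using long by (fastforce simp: W_def)
  qed (rule finite_lists_length_le, simp)
  have comp: "compatible d (f b)" if b: "b \<in> W" for b
    unfolding compatible_def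
  proof (intro allI ballI impI)
    fix u v a a' a'' assume abc: "a \<in> words d" "a' \<in> words d" "a'' \<in> words d"
      and uv: "set u \<subseteq> {1..d}" "set v \<subseteq> {1..d}"
    have ctx: "mon u * p * mon v \<in> ?J" if "p \<in> word_rels d" for p
    proof -
      have p: "p \<in> ?J" using that word_rels_in by blast
      have "mon u * p \<in> ?J"
      proof (cases "u = []")
        case True
        then show ?thesis using p by (simp add: single_one flip: zero_fword_def)
      next
        case False
        then show ?thesis using uv by (intro J(5)[OF p] polys_closed) auto
      qed
      then show ?thesis
      proof (cases "v = []")
        case True
        then show ?thesis using \<open>mon u * p \<in> ?J\<close> by (simp add: single_one flip: zero_fword_def)
      next
        case False
        then show ?thesis using uv by (intro J(6)[OF \<open>mon u * p \<in> ?J\<close>] polys_closed) auto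
      qed
    qed
    have inW: "u @ x @ y @ z @ v \<in> words d"
      if "x \<in> words d" "y \<in> words d" "z \<in> words d" for x y z using that uv by auto
    have rep_add: "vs.representation T (p + q) (mon b) = vs.representation T p (mon b) + vs.representation T q (mon b)"
      if "p \<in> vs.span T" "q \<in> vs.span T" for p q
      using vs.representation_add[OF T(3) that(2,1)] by simp
    note rep_simps = rep_add vs.span_add span_word inW abc
    have "f b (u @ a @ a @ a @ v) = vs.representation T (mon u * (mon a * mon a * mon a) * mon v) (mon b)"
      by (simp add: f_def mon_mult)
    also have "\<dots> = 0"
      using WT[OF b] word_relsI(1)[OF abc] by (intro rep_J ctx)
    finally have 1: "f b (u @ a @ a @ a @ v) = 0" .
    have "mon u * lin2 (mon a) (mon a') * mon v
        = (mon (u @ a @ a @ a' @ v) + mon (u @ a @ a' @ a @ v) + mon (u @ a' @ a @ a @ v) :: 'k nc_poly)"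
      by (simp add: lin2_def distrib_left distrib_right mon_mult)
    moreover have "vs.representation T (mon u * lin2 (mon a) (mon a') * mon v) (mon b) = 0"
      using WT[OF b] word_relsI(2)[OF abc] by (intro rep_J ctx)
    ultimately have 2: "f b (u @ a @ a @ a' @ v) + f b (u @ a @ a' @ a @ v) + f b (u @ a' @ a @ a @ v) = 0"
      unfolding f_def by (simp only: rep_simps)
    have "mon u * lin3 (mon a) (mon a') (mon a'') * mon v
        = (mon (u @ a @ a' @ a'' @ v) + mon (u @ a @ a'' @ a' @ v) + mon (u @ a' @ a @ a'' @ v)
          + mon (u @ a' @ a'' @ a @ v) + mon (u @ a'' @ a @ a' @ v) + mon (u @ a'' @ a' @ a @ v) :: 'k nc_poly)"
      by (simp add: lin3_def distrib_left distrib_right mon_mult)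
    moreover have "vs.representation T (mon u * lin3 (mon a) (mon a') (mon a'') * mon v) (mon b) = 0"
      using WT[OF b] word_relsI(3)[OF abc] by (intro rep_J ctx)
    ultimately have 3: "f b (u @ a @ a' @ a'' @ v) + f b (u @ a @ a'' @ a' @ v) + f b (u @ a' @ a @ a'' @ v)
          + f b (u @ a' @ a'' @ a @ v) + f b (u @ a'' @ a @ a' @ v) + f b (u @ a'' @ a' @ a @ v) = 0"
      unfolding f_def by (simp only: rep_simps)
    from 1 2 3 show "f b (u @ a @ a @ a @ v) = 0
      \<and> f b (u @ a @ a @ a' @ v) + f b (u @ a @ a' @ a @ v) + f b (u @ a' @ a @ a @ v) = 0
      \<and> f b (u @ a @ a' @ a'' @ v) + f b (u @ a @ a'' @ a' @ v) + f b (u @ a' @ a @ a'' @ v)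
          + f b (u @ a' @ a'' @ a @ v) + f b (u @ a'' @ a @ a' @ v) + f b (u @ a'' @ a' @ a @ v) = 0"
      by (intro conjI)
  qed
  have delta: "f b b' = (if b' = b then 1 else 0)" if "b \<in> W" "b' \<in> W" for b b'
    unfolding f_def using WT[OF that(1)] WT[OF that(2)] T(3)
    by (auto simp: vs.representation_basis mon_eq_iff)
  have rest: "mon w - (\<Sum>b\<in>W. scale (f b w) (mon b)) \<in> ?J" if w: "w \<in> words d" for w
  proof -
    let ?r = "vs.representation T (mon w)"
    let ?N = "{v. ?r v \<noteq> 0}"
    have N: "finite ?N" "?N \<subseteq> T"
      using vs.finite_representation vs.representation_ne_zero by blast+
    have inj: "inj_on mon W" by (auto simp: inj_on_def mon_eq_iff)
    have "mon w = (\<Sum>v\<in>?N. scale (?r v) v)"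
      using vs.sum_nonzero_representation_eq[OF T(3) span_word[OF w]] by simp
    \<comment> \<open>The part supported on \<open>S\<close> lies in J; the rest is the sum over
      \<open>W\<close>, padded with zero coefficients.\<close>
    also have "\<dots> = (\<Sum>v\<in>(?N \<inter> S) \<union> mon ` W. scale (?r v) v)"
    proof (rule sum.mono_neutral_left)
      show "?N \<subseteq> ?N \<inter> S \<union> mon ` W" using N(2) T(2) by (auto simp: W_def)
    qed (use N(1) fin in \<open>auto simp: scale_simps\<close>)
    also have "\<dots> = (\<Sum>v\<in>?N \<inter> S. scale (?r v) v) + (\<Sum>v\<in>mon ` W. scale (?r v) v)"
      using N(1) fin WT(2) by (intro sum.union_disjoint) auto
    also have "(\<Sum>v\<in>mon ` W. scale (?r v) v) = (\<Sum>b\<in>W. scale (f b w) (mon b))"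
      by (simp add: sum.reindex[OF inj] f_def)
    finally have "mon w - (\<Sum>b\<in>W. scale (f b w) (mon b)) = (\<Sum>v\<in>?N \<inter> S. scale (?r v) v)"
      unfolding diff_eq_eq .
    also have "\<dots> \<in> ?J"
      using S(1) J(4) by (intro alg_ideal_sum[OF alg_ideal_word_ideal]) auto
    finally show ?thesis .
  qed
  show ?thesis by (rule that[OF fin _ comp delta rest]) (auto simp: W_def)
qed

section \<open>Base change from the two-element field\<close>

definition lift_poly :: "bit nc_poly \<Rightarrow> 'k::field nc_poly"
  where "lift_poly = Poly_Mapping.map emb"

lemma lookup_lift_poly: "Poly_Mapping.lookup (lift_poly p) w = emb (Poly_Mapping.lookup p w)"
  by (simp add: lift_poly_def Poly_Mapping.map.rep_eq when_def)

lemma lift_poly_single: "lift_poly (Poly_Mapping.single w c) = Poly_Mapping.single w (emb c)"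
  by (rule poly_mapping_eqI) (simp add: lookup_lift_poly lookup_single when_def)

lemma lift_poly_zero: "lift_poly 0 = 0"
  by (rule poly_mapping_eqI) (simp add: lookup_lift_poly)

context
  assumes char: "CHAR('k::field) = 2"
begin

lemma lift_poly_add: "(lift_poly (p + q) :: 'k nc_poly) = lift_poly p + lift_poly q"
  by (rule poly_mapping_eqI) (simp only: lookup_lift_poly lookup_add emb_add[OF char])

lemma lift_poly_sum: "(lift_poly (sum g A) :: 'k nc_poly) = (\<Sum>i\<in>A. lift_poly (g i))"
  by (induction A rule: infinite_finite_induct) (simp_all only: sum.infinite sum.empty sum.insert lift_poly_zero lift_poly_add not_False_eq_True)

lemma lift_poly_mult: "(lift_poly (p * q) :: 'k nc_poly) = lift_poly p * lift_poly q"
proof -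
  let ?s = "\<lambda>p :: bit nc_poly. \<Sum>w\<in>Poly_Mapping.keys p. Poly_Mapping.single w (Poly_Mapping.lookup p w)"
  have "(lift_poly (?s p * ?s q) :: 'k nc_poly) = lift_poly (?s p) * lift_poly (?s q)"
    by (simp only: sum_product lift_poly_sum mult_single lift_poly_single emb_simps)
  then show ?thesis by (simp only: sum_single_lookup)
qed

lemma lift_poly_lin:
  "lift_poly (lin2 p q) = lin2 (lift_poly p) (lift_poly q :: 'k nc_poly)"
  "lift_poly (lin3 p q r) = lin3 (lift_poly p) (lift_poly q) (lift_poly r :: 'k nc_poly)"
  by (simp_all only: lin2_def lin3_def lift_poly_add lift_poly_mult)

lemma lift_poly_in_polys: "p \<in> polys d \<Longrightarrow> (lift_poly p :: 'k nc_poly) \<in> polys d"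
  by (auto simp: polys_iff in_keys_iff lookup_lift_poly emb_def split: if_splits)

text \<open>Lifting is multiplicative, so the preimage of J is an ideal over F_2, and each word
  relation is lifted to the relation of the same form.\<close>

lemma lift_poly_word_ideal:
  assumes "p \<in> word_ideal d"
  shows "(lift_poly p :: 'k nc_poly) \<in> word_ideal d"
proof -
  let ?J = "word_ideal d :: 'k nc_poly set"
  note J = ideal_closed[OF alg_ideal_word_ideal[of d, where 'k = 'k]]
  define K where "K = {p \<in> polys d. lift_poly p \<in> ?J}"
  have "alg_ideal (free_alg d) K"
    unfolding alg_ideal_iff
  proof (intro conjI ballI allI)
    show "K \<subseteq> polys d" "0 \<in> K" using J(2) by (auto simp: K_def lift_poly_zero)
    fix x y assume "x \<in> K" "y \<in> K"
    then show "x + y \<in> K" by (simp add: K_def lift_poly_add J(3))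
  next
    fix c :: bit and x assume "x \<in> K"
    moreover have "0 \<in> K" using J(2) by (simp add: K_def lift_poly_zero)
    moreover have "scale (0 :: bit) x = 0" "scale (1 :: bit) x = x" by (rule scale_simps)+
    ultimately show "scale c x \<in> K" by (cases c) (simp_all only:)
  next
    fix x a :: "bit nc_poly" assume "x \<in> K" "a \<in> polys d"
    then show "a * x \<in> K" "x * a \<in> K"
      by (auto simp: K_def lift_poly_mult intro: J(5,6) lift_poly_in_polys)
  qed
  moreover have "word_rels d \<subseteq> K"
  proof
    fix p :: "bit nc_poly" assume p: "p \<in> word_rels d"
    have lift_mon: "lift_poly (mon a) = (mon a :: 'k nc_poly)" for a
      by (simp only: lift_poly_single emb_simps)
    consider a where "a \<in> words d" "p = mon a * mon a * mon a"
      | a b where "a \<in> words d" "b \<in> words d" "p = lin2 (mon a) (mon b)"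
      | a b c where "a \<in> words d" "b \<in> words d" "c \<in> words d" "p = lin3 (mon a) (mon b) (mon c)"
      using p unfolding word_rels_def by blast
    then have "lift_poly p \<in> (word_rels d :: 'k nc_poly set)"
      by cases (simp_all only: lift_poly_lin lift_poly_mult lift_mon word_relsI)
    then show "p \<in> K" using p word_rels_subset word_rels_in by (auto simp: K_def)
  qed
  ultimately have "word_ideal d \<subseteq> K" unfolding word_ideal_def by (rule gen_ideal_least)
  then show ?thesis using assms by (auto simp: K_def)
qed

end

lemma lift_poly_diff:
  "CHAR('k::field) = 2 \<Longrightarrow> (lift_poly (p - q) :: 'k nc_poly) = lift_poly p - lift_poly q"
  by (rule poly_mapping_eqI) (simp only: lookup_lift_poly lookup_minus emb_diff)

lemma lift_poly_scale_mon: "lift_poly (scale c (mon w)) = scale (emb c) (mon w)"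
  by (simp only: scale_simps lift_poly_single emb_simps)

text \<open>All data live over F_2. For any field of characteristic 2, lifting the expansions shows
  that \<open>W\<close> spans modulo J, and evaluating the functionals through \<open>emb\<close>
  shows that it is independent.\<close>

locale word_basis =
  fixes d :: nat and W :: "nat list set" and f :: "nat list \<Rightarrow> nat list \<Rightarrow> bit"
  assumes finite_W: "finite W" and W_words: "W \<subseteq> words d"
    and compatible_f: "b \<in> W \<Longrightarrow> compatible d (f b)"
    and f_W: "b \<in> W \<Longrightarrow> b' \<in> W \<Longrightarrow> f b b' = (if b' = b then 1 else 0)"
    and word_expansion: "w \<in> words d \<Longrightarrow>
      mon w - (\<Sum>b\<in>W. scale (f b w) (mon b)) \<in> (word_ideal d :: bit nc_poly set)"
begin

lemma expansion:
  assumes char: "CHAR('k::field) = 2" and p: "(p :: 'k nc_poly) \<in> polys d"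
  shows "\<exists>c. p - (\<Sum>b\<in>W. scale (c b) (mon b)) \<in> word_ideal d"
  using p
proof (induction p rule: polys_induct)
  case zero
  show ?case
    using ideal_closed(2)[OF alg_ideal_word_ideal[of d, where 'k = 'k]]
    by (intro exI[of _ "\<lambda>_. 0"]) (simp add: scale_simps)
next
  case (single c w)
  have "lift_poly (mon w - (\<Sum>b\<in>W. scale (f b w) (mon b))) \<in> (word_ideal d :: 'k nc_poly set)"
    using single by (intro lift_poly_word_ideal[OF char] word_expansion)
  also have "lift_poly (mon w - (\<Sum>b\<in>W. scale (f b w) (mon b)))
      = (mon w - (\<Sum>b\<in>W. scale (emb (f b w)) (mon b)) :: 'k nc_poly)"
    by (simp only: lift_poly_diff[OF char] lift_poly_sum[OF char] lift_poly_scale_mon)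
      (simp only: lift_poly_single emb_simps)
  finally have "scale c (mon w - (\<Sum>b\<in>W. scale (emb (f b w)) (mon b))) \<in> (word_ideal d :: 'k nc_poly set)"
    by (rule ideal_closed(4)[OF alg_ideal_word_ideal])
  also have "scale c (mon w - (\<Sum>b\<in>W. scale (emb (f b w)) (mon b)))
      = Poly_Mapping.single (Word w) c - (\<Sum>b\<in>W. scale (c * emb (f b w)) (mon b))"
    by (simp only: scale_diff scale_sum scale_simps(3) single_eq_scale[of w c])
  finally show ?case by (rule exI[of _ "\<lambda>b. c * emb (f b w)"])
next
  case (add p q)
  then obtain c c' where "p - (\<Sum>b\<in>W. scale (c b) (mon b)) \<in> word_ideal d"
    "q - (\<Sum>b\<in>W. scale (c' b) (mon b)) \<in> word_ideal d" by blast
  from ideal_closed(3)[OF alg_ideal_word_ideal this]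
  have "p + q - (\<Sum>b\<in>W. scale (c b + c' b) (mon b)) \<in> word_ideal d"
    by (simp only: scale_simps(2) sum.distrib add_diff_add)
  then show ?case by (rule exI[of _ "\<lambda>b. c b + c' b"])
qed

lemma independent:
  assumes char: "CHAR('k::field) = 2"
    and c: "(\<Sum>b\<in>W. scale (c b :: 'k) (mon b)) \<in> word_ideal d"
  shows "\<forall>b\<in>W. c b = 0"
proof
  fix b assume b: "b \<in> W"
  have "0 = functional (f b) (\<Sum>b\<in>W. scale (c b) (mon b))"
    using functional_word_ideal[OF char compatible_f[OF b] c] by (rule sym)
  also have "\<dots> = (\<Sum>b'\<in>W. c b' * emb (f b b'))"
    by (simp only: functional_sum functional_scale functional_mon)
  also have "\<dots> = (\<Sum>b'\<in>W. if b' = b then c b' else 0)"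
    using f_W[OF b] by (intro sum.cong) auto
  also have "\<dots> = c b" using finite_W b by simp
  finally show "c b = 0" by simp
qed

lemma dim_infinite:
  assumes char: "CHAR('k::field) = 2" and inf: "infinite (UNIV :: 'k set)"
  shows "alg_fin_dim (N_alg 3 d :: ('k, _) module)" "alg_dim (N_alg 3 d :: ('k, _) module) = card W"
proof -
  have eq: "cube_ideal d = (word_ideal d :: 'k nc_poly set)"
    using word_ideal_subset[OF char inf] cube_ideal_subset by blast
  have mon: "mon b \<in> (polys d :: 'k nc_poly set)" if "b \<in> W" for b
    using that W_words by (intro polys_closed) blast
  show "alg_fin_dim (N_alg 3 d :: ('k, _) module)" "alg_dim (N_alg 3 d :: ('k, _) module) = card W"
    unfolding N_alg_3 eq
    by (rule dim_quot[OF alg_ideal_word_ideal finite_W mon expansion[OF char] independent[OF char]]; assumption)+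
qed

end

lemma word_basis_exists: "\<exists>W f. word_basis d W f"
proof (rule word_basis_coordinates[OF CHAR_bit, of d])
  fix W and f :: "nat list \<Rightarrow> nat list \<Rightarrow> bit"
  assume "finite W" "W \<subseteq> words d" "\<And>b. b \<in> W \<Longrightarrow> compatible d (f b)"
    "\<And>b b'. b \<in> W \<Longrightarrow> b' \<in> W \<Longrightarrow> f b b' = (if b' = b then 1 else 0)"
    "\<And>w. w \<in> words d \<Longrightarrow> mon w - (\<Sum>b\<in>W. scale (f b w) (mon b)) \<in> word_ideal d"
  then have "word_basis d W f" by (rule word_basis.intro)
  then show "\<exists>W f. word_basis d W f" by (intro exI)
qed

subsection \<open>The additional elements over the two-element field\<close>

text \<open>The larger index comes first, so \<open>lin2_pair\<close> is B(x_i, x_j) with i <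
  j.\<close>

definition pairs :: "nat \<Rightarrow> (nat \<times> nat) set"
  where "pairs d = (SIGMA j:{1..d}. {1..<j})"

abbreviation lin2_pair :: "nat \<times> nat \<Rightarrow> 'k::field nc_poly"
  where "lin2_pair x \<equiv> lin2 (mon [snd x]) (mon [fst x])"

lemma finite_pairs: "finite (pairs d)"
  by (simp add: pairs_def)

lemma card_pairs: "card (pairs d) = d * (d - 1) div 2"
proof -
  have "card (pairs d) = (\<Sum>j\<in>{1..d}. j - 1)" by (simp add: pairs_def)
  also have "\<dots> = d * (d - 1) div 2"
  proof (induction d)
    case (Suc d)
    then show ?case by (cases d) auto
  qed simp
  finally show ?thesis .
qed

text \<open>I together with the span of the \<open>lin2_pair\<close> elements is already an ideal,
  because multiplying such an element by anything leads into I.\<close>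

lemma word_ideal_mod_cube_ideal:
  assumes char: "CHAR('k::field) = 2" and p: "p \<in> (word_ideal d :: 'k nc_poly set)"
  shows "\<exists>c. p - (\<Sum>x\<in>pairs d. scale (c x) (lin2_pair x)) \<in> cube_ideal d"
proof -
  let ?I = "cube_ideal d :: 'k nc_poly set"
  note ideal = alg_ideal_cube_ideal[of d, where 'k = 'k]
  note I = ideal_closed[OF ideal]
  interpret nil_cube "polys d" ?I by (rule nil_cube_cube_ideal[OF char])
  let ?t = "\<lambda>c. \<Sum>x\<in>pairs d. scale (c x :: 'k) (lin2_pair x)"
  define K where "K = {p \<in> polys d. \<exists>c. p - ?t c \<in> ?I}"
  have K_in: "q \<in> K" if "q \<in> polys d" "q - ?t c \<in> ?I" for q c
    unfolding K_def using that by (intro CollectI conjI exI[of _ c])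
  have K_I: "q \<in> K" if "q \<in> ?I" for q
    using that I(1) by (intro K_in[of q "\<lambda>_. 0"]) (auto simp: scale_simps)
  have letter: "mon [i] \<in> (polys d :: 'k nc_poly set)" if "i \<in> {1..d}" for i
    using that by (intro polys_closed) simp
  have t_mult: "a * lin2_pair x \<in> ?I" "lin2_pair x * a \<in> ?I" if "x \<in> pairs d" "a \<in> polys d" for a x
    using that by (auto simp: pairs_def intro!: mult_lin2_in lin2_mult_in letter)
  have mult: "a * p \<in> K \<and> p * a \<in> K" if p: "p \<in> K" and a: "a \<in> polys d" for p a
  proof -
    obtain c where c: "p - ?t c \<in> ?I" using p by (auto simp: K_def)
    have "a * ?t c \<in> ?I" "?t c * a \<in> ?I"
      unfolding sum_distrib_left sum_distrib_right
      by (intro alg_ideal_sum[OF ideal];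
          simp only: scale_mult_right[symmetric] scale_mult_left[symmetric] I(4) t_mult a)+
    moreover have "a * (p - ?t c) \<in> ?I" "(p - ?t c) * a \<in> ?I" using I c a by auto
    ultimately have "a * (p - ?t c) + a * ?t c \<in> ?I" "(p - ?t c) * a + ?t c * a \<in> ?I"
      by (simp_all only: I(3))
    then have "a * p \<in> ?I" "p * a \<in> ?I" by (simp_all add: algebra_simps)
    then show ?thesis using K_I by blast
  qed
  have "alg_ideal (free_alg d) K"
    unfolding alg_ideal_iff
  proof (intro conjI ballI allI)
    show "K \<subseteq> polys d" by (auto simp: K_def)
    show "0 \<in> K" by (rule K_I[OF I(2)])
    fix x y assume "x \<in> K" "y \<in> K"
    then obtain c c' where "x - ?t c \<in> ?I" "y - ?t c' \<in> ?I" "x \<in> polys d" "y \<in> polys d"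
      by (auto simp: K_def)
    moreover from this have "x + y \<in> polys d" by blast
    moreover have "x + y - ?t (\<lambda>x. c x + c' x) \<in> ?I"
      using I(3)[of "x - ?t c" "y - ?t c'"] calculation(1,2) by (simp only: scale_simps(2) sum.distrib add_diff_add)
    ultimately show "x + y \<in> K" by (intro K_in)
  next
    fix a x assume "x \<in> K"
    then obtain c where "x - ?t c \<in> ?I" "x \<in> polys d" by (auto simp: K_def)
    moreover have "scale a (x - ?t c) = scale a x - ?t (\<lambda>x. a * c x)"
      by (simp only: scale_diff scale_sum scale_simps(3))
    ultimately have "scale a x - ?t (\<lambda>x. a * c x) \<in> ?I" "scale a x \<in> polys d"
      using I(4)[of "x - ?t c" a] by auto
    then show "scale a x \<in> K" by (intro K_in)
  qed (use mult in auto)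
  moreover have "word_rels d \<subseteq> K"
  proof
    fix p :: "'k nc_poly" assume p: "p \<in> word_rels d"
    have mon: "mon a \<in> (polys d :: 'k nc_poly set)" if "a \<in> words d" for a
      using that by (rule polys_closed)
    consider a where "a \<in> words d" "p = mon a * mon a * mon a"
      | a b where "a \<in> words d" "b \<in> words d" "p = lin2 (mon a) (mon b)"
      | a b c where "a \<in> words d" "b \<in> words d" "c \<in> words d" "p = lin3 (mon a) (mon b) (mon c)"
      using p unfolding word_rels_def by blast
    then show "p \<in> K"
    proof cases
      case 1
      then show ?thesis using mon by (auto intro!: K_I cube_in)
    next
      case 3
      then show ?thesis using mon by (auto intro!: K_I lin3_in)
    next
      case 2
      have long: "lin2 q (mon w) \<in> ?I" if "w \<in> words d" "tl w \<noteq> []" "q \<in> polys d" for q w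
      proof -
        have "mon w = (mon [hd w] * mon (tl w) :: 'k nc_poly)"
          using that(1) by (cases w) (auto simp: mon_mult)
        moreover have "[hd w] \<in> words d" "tl w \<in> words d"
          using that(1,2) by (cases w; auto)+
        ultimately show ?thesis using lin2_product_in[OF that(3) mon mon] by simp
      qed
      have swap: "lin2 (mon a) (mon b) + lin2 (mon b) (mon a) \<in> ?I" using 2 mon by blast
      have sub: "lin2 (mon a) (mon b) = lin2 (mon a) (mon b) + lin2 (mon b) (mon a) + lin2 (mon b) (mon a :: 'k nc_poly)"
        by (simp add: add.assoc)
      \<comment> \<open>A longer \<open>b\<close> is settled by \<open>lin2_product_in\<close>, a
        longer \<open>a\<close> by swapping first. For two letters, equal ones give a cube, and the
        order i > j is swapped to the listed pair.\<close>
      consider "tl b \<noteq> []" | "tl a \<noteq> []" | i j where "a = [i]" "b = [j]"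
        using 2 by (cases a; cases b) auto
      then show ?thesis
      proof cases
        case 1
        then show ?thesis using 2 long mon by (auto intro!: K_I)
      next
        case a: 2
        then have "lin2 (mon b) (mon a) \<in> ?I" using 2 long mon by auto
        with swap have "lin2 (mon a) (mon b) \<in> ?I" by (subst sub) (rule I_add)
        then show ?thesis using 2 K_I by simp
      next
        case ij: 3
        have pair_in: "q - lin2_pair x \<in> ?I \<Longrightarrow> q \<in> polys d \<Longrightarrow> q \<in> K" if "x \<in> pairs d" for q x
        proof -
          assume q: "q - lin2_pair x \<in> ?I" "q \<in> polys d"
          have "?t (\<lambda>y. if y = x then 1 else 0) = (\<Sum>y\<in>pairs d. if y = x then lin2_pair y else 0)"
            by (rule sum.cong) (simp_all add: scale_simps)
          also have "\<dots> = lin2_pair x" using that finite_pairs by simp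
          finally have "q - ?t (\<lambda>y. if y = x then 1 else 0) \<in> ?I" using q by simp
          then show "q \<in> K" using q by (intro K_in)
        qed
        have "p \<in> polys d" using p word_rels_subset by blast
        have mem: "i \<in> {1..d}" "j \<in> {1..d}" using 2 ij by auto
        consider "i = j" | "i < j" | "j < i" by linarith
        then show ?thesis
        proof cases
          case 1
          have "lin2 x x = x * x * x" for x :: "'k nc_poly" by (simp add: lin2_def)
          then show ?thesis using 2 1 ij mon by (auto intro!: K_I)
        next
          case lt: 2
          then have "(j, i) \<in> pairs d" using mem by (auto simp: pairs_def)
          moreover have "p - lin2_pair (j, i) \<in> ?I" using 2(3) ij I(2) by simp
          ultimately show ?thesis using pair_in \<open>p \<in> polys d\<close> by blast
        next
          case gt: 3
          then have "(i, j) \<in> pairs d" using mem by (auto simp: pairs_def)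
          moreover have "p - lin2_pair (i, j) = lin2 (mon a) (mon b) + lin2 (mon b) (mon a)"
            using 2(3) ij double_zero_poly[OF char, of "lin2 (mon b) (mon a)"]
            by (simp add: diff_eq_eq add.assoc)
          ultimately show ?thesis using pair_in[of "(i, j)" p] \<open>p \<in> polys d\<close> swap by simp
        qed
      qed
    qed
  qed
  ultimately have "word_ideal d \<subseteq> K" unfolding word_ideal_def by (rule gen_ideal_least)
  then show ?thesis using p by (auto simp: K_def)
qed

section \<open>Coefficients of words of length three\<close>

lemma lookup_mult_word:
  "Poly_Mapping.lookup (p * q) (Word w)
    = (\<Sum>k\<le>length w. Poly_Mapping.lookup p (Word (take k w)) * Poly_Mapping.lookup q (Word (drop k w)))"
  for p q :: "'k::field nc_poly"
proof -
  let ?s = "\<lambda>p :: 'k nc_poly. \<Sum>w\<in>Poly_Mapping.keys p. Poly_Mapping.single w (Poly_Mapping.lookup p w)"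
  have single: "Poly_Mapping.lookup (Poly_Mapping.single u a * Poly_Mapping.single v b) (Word w)
      = (\<Sum>k\<le>length w. Poly_Mapping.lookup (Poly_Mapping.single u a) (Word (take k w))
          * Poly_Mapping.lookup (Poly_Mapping.single v b) (Word (drop k w)))" for u v and a b :: 'k
  proof -
    obtain u' v' where uv: "u = Word u'" "v = Word v'" by (metis fword.exhaust)
    have "(\<Sum>k\<le>length w. Poly_Mapping.lookup (Poly_Mapping.single u a) (Word (take k w))
          * Poly_Mapping.lookup (Poly_Mapping.single v b) (Word (drop k w)))
        = (\<Sum>k\<le>length w. if k = length u' then (if w = u' @ v' then a * b else 0) else 0)"
    proof (rule sum.cong)
      fix k assume "k \<in> {..length w}"
      then have iff: "(u' = take k w \<and> v' = drop k w) \<longleftrightarrow> (k = length u' \<and> w = u' @ v')"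
        by (auto simp: append_eq_conv_conj)
      have "Poly_Mapping.lookup (Poly_Mapping.single u a) (Word (take k w))
          * Poly_Mapping.lookup (Poly_Mapping.single v b) (Word (drop k w))
          = (if u' = take k w \<and> v' = drop k w then a * b else 0)"
        by (simp add: uv lookup_single when_def)
      also have "\<dots> = (if k = length u' then (if w = u' @ v' then a * b else 0) else 0)"
        unfolding iff by simp
      finally show "Poly_Mapping.lookup (Poly_Mapping.single u a) (Word (take k w))
          * Poly_Mapping.lookup (Poly_Mapping.single v b) (Word (drop k w))
          = (if k = length u' then (if w = u' @ v' then a * b else 0) else 0)" .
    qed simp
    also have "\<dots> = (if w = u' @ v' then a * b else 0)" by auto
    finally show ?thesis by (auto simp: uv mult_single lookup_single when_def plus_fword_def)
  qed
  have "Poly_Mapping.lookup (?s p * ?s q) (Word w)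
    = (\<Sum>k\<le>length w. Poly_Mapping.lookup (?s p) (Word (take k w)) * Poly_Mapping.lookup (?s q) (Word (drop k w)))"
    unfolding sum_product lookup_sum single
    by (subst (2) sum.swap) (subst sum.swap, intro sum.cong refl sum.swap)
  then show ?thesis by (simp only: sum_single_lookup)
qed

lemma lookup_Nil: "p \<in> polys d \<Longrightarrow> Poly_Mapping.lookup p (Word []) = 0"
  unfolding polys_iff by (metis (mono_tags, lifting) fword.sel in_keys_iff mem_Collect_eq)

text \<open>If l_i is the coefficient of the letter i in an element, its cube has the two
  coefficients l_i^2 l_j and l_j^2 l_i; both equal l_i l_j because every element of F_2 is
  idempotent.\<close>

lemma lookup_cube_ideal:
  assumes p: "p \<in> (cube_ideal d :: bit nc_poly set)"
  shows "Poly_Mapping.lookup p (Word [i, i, j]) = Poly_Mapping.lookup p (Word [j, j, i])"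
proof -
  \<comment> \<open>Vanishing on words of length at most 2 makes every product with a further factor
    vanish on words of length 3; this is why \<open>K\<close> is an ideal.\<close>
  define K where "K = {p \<in> (polys d :: bit nc_poly set).
    (\<forall>w. length w \<le> 2 \<longrightarrow> Poly_Mapping.lookup p (Word w) = 0)
    \<and> (\<forall>i j. Poly_Mapping.lookup p (Word [i, i, j]) = Poly_Mapping.lookup p (Word [j, j, i]))}"
  have mult: "Poly_Mapping.lookup (a * p) (Word w) = 0" "Poly_Mapping.lookup (p * a) (Word w) = 0"
    if "p \<in> K" "a \<in> polys d" "length w \<le> 3" for a p w
  proof -
    have "Poly_Mapping.lookup a (Word (take k w)) * Poly_Mapping.lookup p (Word (drop k w)) = 0" for k
      using that lookup_Nil[of a d] by (cases "k = 0") (auto simp: K_def)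
    then show "Poly_Mapping.lookup (a * p) (Word w) = 0"
      unfolding lookup_mult_word by (intro sum.neutral) blast
    have "Poly_Mapping.lookup p (Word (take k w)) * Poly_Mapping.lookup a (Word (drop k w)) = 0" for k
      using that lookup_Nil[of a d] by (cases "k < length w") (auto simp: K_def)
    then show "Poly_Mapping.lookup (p * a) (Word w) = 0"
      unfolding lookup_mult_word by (intro sum.neutral) blast
  qed
  have "alg_ideal (free_alg d) K"
    unfolding alg_ideal_iff
  proof (intro conjI ballI allI)
    show "K \<subseteq> polys d" "0 \<in> K" by (auto simp: K_def)
    fix x y assume xy: "x \<in> K" "y \<in> K"
    then have "x + y \<in> polys d" by (auto simp: K_def)
    with xy show "x + y \<in> K" by (simp add: K_def lookup_add)
  next
    fix c :: bit and x assume x: "x \<in> K"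
    then have "scale c x \<in> polys d" by (intro polys_closed) (simp add: K_def)
    with x show "scale c x \<in> K"
      unfolding K_def mem_Collect_eq lookup_smult by (metis mult_zero_right)
  next
    fix x a :: "bit nc_poly" assume x: "x \<in> K" and a: "a \<in> polys d"
    then have "a * x \<in> polys d" "x * a \<in> polys d" by (auto simp: K_def)
    with mult[OF x a] show "a * x \<in> K" "x * a \<in> K" by (auto simp: K_def)
  qed
  moreover have "(\<lambda>x. x * x * x) ` polys d \<subseteq> K"
  proof safe
    fix x :: "bit nc_poly" assume x: "x \<in> polys d"
    let ?l = "\<lambda>i. Poly_Mapping.lookup x (Word [i])"
    have 1: "Poly_Mapping.lookup (x * x) (Word w) = 0" if "length w \<le> 1" for w
      using that lookup_Nil[OF x] by (cases w) (auto simp: lookup_mult_word)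
    have 2: "Poly_Mapping.lookup (x * x) (Word [i, j]) = ?l i * ?l j" for i j
      using lookup_Nil[OF x] by (simp add: lookup_mult_word)
    have "Poly_Mapping.lookup (x * x * x) (Word w) = 0" if "length w \<le> 2" for w
      unfolding lookup_mult_word[of "x * x"]
    proof (rule sum.neutral, safe)
      fix k
      show "Poly_Mapping.lookup (x * x) (Word (take k w)) * Poly_Mapping.lookup x (Word (drop k w)) = 0"
        using that lookup_Nil[OF x] 1[of "take k w"] by (cases "k \<le> 1") auto
    qed
    moreover have "Poly_Mapping.lookup (x * x * x) (Word [i, j, k]) = ?l i * ?l j * ?l k" for i j k
      unfolding lookup_mult_word[of "x * x"] using lookup_Nil[OF x] 1[of "[]"] 1[of "[i]"] 2[of i j] by simp
    then have "Poly_Mapping.lookup (x * x * x) (Word [i, i, j]) = Poly_Mapping.lookup (x * x * x) (Word [j, j, i])" for i j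
      by (cases "?l i"; cases "?l j") simp_all
    moreover have "x * x * x \<in> polys d" using x by auto
    ultimately show "x * x * x \<in> K" by (simp add: K_def)
  qed
  ultimately have "cube_ideal d \<subseteq> K" unfolding cube_ideal_def by (rule gen_ideal_least)
  then show ?thesis using p unfolding K_def by blast
qed

lemma lookup_lin2_pair:
  assumes "x \<in> pairs d" "y \<in> pairs d"
  shows "Poly_Mapping.lookup (lin2_pair x :: 'k::field nc_poly) (Word [snd y, snd y, fst y]) = (if x = y then 1 else 0)"
    "Poly_Mapping.lookup (lin2_pair x :: 'k nc_poly) (Word [fst y, fst y, snd y]) = 0"
proof -
  have lookup: "Poly_Mapping.lookup (lin2_pair x :: 'k nc_poly) (Word w)
      = (1 when [snd x, snd x, fst x] = w) + (1 when [snd x, fst x, snd x] = w) + (1 when [fst x, snd x, snd x] = w)" for w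
    by (simp only: lin2_def mon_mult lookup_add lookup_single fword.inject append.simps)
  have "snd x < fst x" "snd y < fst y" using assms by (auto simp: pairs_def)
  then show "Poly_Mapping.lookup (lin2_pair x :: 'k nc_poly) (Word [snd y, snd y, fst y]) = (if x = y then 1 else 0)"
    "Poly_Mapping.lookup (lin2_pair x :: 'k nc_poly) (Word [fst y, fst y, snd y]) = 0"
    unfolding lookup by (auto simp: when_def prod_eq_iff)
qed

lemma pairs_independent:
  assumes c: "(\<Sum>x\<in>pairs d. scale (c x) (lin2_pair x)) \<in> (cube_ideal d :: bit nc_poly set)"
  shows "\<forall>x\<in>pairs d. c x = 0"
proof
  fix y assume y: "y \<in> pairs d"
  let ?s = "\<Sum>x\<in>pairs d. scale (c x) (lin2_pair x)"
  have "Poly_Mapping.lookup ?s (Word [snd y, snd y, fst y]) = (\<Sum>x\<in>pairs d. if x = y then c x else 0)"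
    unfolding lookup_sum lookup_smult
    by (intro sum.cong refl) (simp only: lookup_lin2_pair(1)[OF _ y] if_distrib[of "(*) _"] mult_1_right mult_zero_right)
  also have "\<dots> = c y" using y finite_pairs by simp
  finally have "Poly_Mapping.lookup ?s (Word [snd y, snd y, fst y]) = c y" .
  moreover have "Poly_Mapping.lookup ?s (Word [fst y, fst y, snd y]) = 0"
    unfolding lookup_sum lookup_smult
    by (intro sum.neutral ballI) (simp only: lookup_lin2_pair(2)[OF _ y] mult_zero_right)
  ultimately show "c y = 0" using lookup_cube_ideal[OF c] by metis
qed

text \<open>The words of \<open>W\<close> account for the quotient by J, the pairs for J modulo I. A
  relation is first read modulo J, where the pairs vanish; once its coefficients on \<open>W\<close>
  are zero, it concerns the pairs alone.\<close>

lemma (in word_basis) dim_if_pairs_independent: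
  assumes char: "CHAR('k::field) = 2"
    and indep: "\<And>c. (\<Sum>x\<in>pairs d. scale (c x) (lin2_pair x)) \<in> (cube_ideal d :: 'k nc_poly set)
      \<Longrightarrow> \<forall>x\<in>pairs d. c x = 0"
  shows "alg_fin_dim (N_alg 3 d :: ('k, _) module)"
    "alg_dim (N_alg 3 d :: ('k, _) module) = card W + card (pairs d)"
proof -
  let ?I = "cube_ideal d :: 'k nc_poly set"
  let ?e = "case_sum mon lin2_pair :: nat list + nat \<times> nat \<Rightarrow> 'k nc_poly"
  have fin: "finite (W <+> pairs d)" using finite_W finite_pairs by simp
  have sum_Plus: "(\<Sum>i\<in>W <+> pairs d. scale (c i) (?e i))
      = (\<Sum>b\<in>W. scale (c (Inl b)) (mon b)) + (\<Sum>x\<in>pairs d. scale (c (Inr x)) (lin2_pair x))" for c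
    using finite_W finite_pairs by (simp add: sum.Plus)
  have letter: "mon [i] \<in> (polys d :: 'k nc_poly set)" if "i \<in> {1..d}" for i
    using that by (intro polys_closed) simp
  have e: "?e i \<in> polys d" if "i \<in> W <+> pairs d" for i
    using that
  proof (rule PlusE)
    fix b assume "b \<in> W" "i = Inl b"
    then show ?thesis using W_words polys_closed(5)[of b d 1] by auto
  next
    fix x assume "x \<in> pairs d" "i = Inr x"
    then show ?thesis by (auto simp: pairs_def intro!: lin_closed letter)
  qed
  have span: "\<exists>c. p - (\<Sum>i\<in>W <+> pairs d. scale (c i) (?e i)) \<in> ?I" if p: "p \<in> polys d" for p
  proof -
    obtain c where "p - (\<Sum>b\<in>W. scale (c b) (mon b)) \<in> word_ideal d" using expansion[OF char p] by blast
    from word_ideal_mod_cube_ideal[OF char this]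
    obtain c' where "p - (\<Sum>b\<in>W. scale (c b) (mon b)) - (\<Sum>x\<in>pairs d. scale (c' x) (lin2_pair x)) \<in> ?I" by blast
    then show ?thesis by (intro exI[of _ "case_sum c c'"]) (simp add: sum_Plus diff_diff_eq)
  qed
  have ind: "\<forall>i\<in>W <+> pairs d. c i = 0" if c: "(\<Sum>i\<in>W <+> pairs d. scale (c i) (?e i)) \<in> ?I" for c
  proof -
    let ?b = "\<Sum>b\<in>W. scale (c (Inl b)) (mon b) :: 'k nc_poly"
    let ?t = "\<Sum>x\<in>pairs d. scale (c (Inr x)) (lin2_pair x) :: 'k nc_poly"
    have "?t \<in> word_ideal d"
    proof (rule alg_ideal_sum[OF alg_ideal_word_ideal])
      fix x assume "x \<in> pairs d"
      then have "lin2_pair x \<in> (word_ideal d :: 'k nc_poly set)"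
        by (auto simp: pairs_def intro!: lin2_in_word_ideal letter)
      then show "scale (c (Inr x)) (lin2_pair x) \<in> word_ideal d"
        by (rule ideal_closed(4)[OF alg_ideal_word_ideal])
    qed
    moreover have "?b + ?t \<in> word_ideal d" using c cube_ideal_subset unfolding sum_Plus by blast
    ultimately have "(?b + ?t) - ?t \<in> word_ideal d" using alg_ideal_minus(2)[OF alg_ideal_word_ideal] by blast
    then have "?b \<in> word_ideal d" by simp
    then have b0: "\<forall>b\<in>W. c (Inl b) = 0" by (rule independent[OF char])
    then have "?b = 0" by (intro sum.neutral) (simp add: scale_simps)
    then have "?t \<in> ?I" using c unfolding sum_Plus by simp
    then have "\<forall>x\<in>pairs d. c (Inr x) = 0" by (rule indep)
    with b0 show ?thesis by auto
  qed
  show "alg_fin_dim (N_alg 3 d :: ('k, _) module)"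
    "alg_dim (N_alg 3 d :: ('k, _) module) = card W + card (pairs d)"
    unfolding N_alg_3
    using dim_quot[OF alg_ideal_cube_ideal fin e span ind] finite_W finite_pairs
    by (simp_all add: card_Plus)
qed

theorem theorem3p1:
  fixes d :: nat
  assumes "2 \<le> d"
    and "infinite (UNIV :: 'l::field set)"
    and "CHAR('l) = 2"
  shows "C_deg 3 d TYPE(bit) = C_deg 3 d TYPE('l)
    \<and> C_deg 3 d TYPE('l) = (if d = 2 then 6 else d + 3)
    \<and> alg_fin_dim (N_alg 3 d :: (bit, _) module)
    \<and> alg_fin_dim (N_alg 3 d :: ('l, _) module)
    \<and> alg_dim (N_alg 3 d :: (bit, _) module)
        = alg_dim (N_alg 3 d :: ('l, _) module) + d * (d - 1) div 2"
proof -
  obtain W f where "word_basis d W f" using word_basis_exists by blast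
  then interpret word_basis d W f .
  have "C_deg 3 d TYPE('l) = (if d = 2 then 6 else d + 3)"
    using C_deg_3[OF assms(3,1)] assms(1) by (simp add: max_def)
  then show ?thesis
    using C_deg_3[OF assms(3,1)] C_deg_3[OF CHAR_bit assms(1)] dim_infinite[OF assms(3,2)]
      dim_if_pairs_independent[OF CHAR_bit pairs_independent] card_pairs[of d] by simp
qed

end
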